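(* Let $\beta_2\ge\beta_1>1$ be real numbers. For any $0<v<\infty$, $$\dim_{\mathrm H}A_{\beta_1,\beta_2}(v)=\dim_{\mathrm H}W_{\beta_1,\beta_2}(v)=\begin{cases}\dfrac{2+v-v\log_{\beta_2}\beta_1}{1+v} & \text{if }\beta_1^{1+v}<\beta_2,\\[2mm] \min\left\{\dfrac{1+\log_{\beta_2}\beta_1}{(1+v)\log_{\beta_2}\beta_1},\ \dfrac{2+v-v\log_{\beta_2}\beta_1}{1+v}\right\} & \text{if }\beta_1^{1+v}\ge\beta_2.\end{cases}$$ When $v=0$, $\dim_{\mathrm H}A_{\beta_1,\beta_2}(0)=2$; when $v=\infty$, $\dim_{\mathrm H}A_{\beta_1,\beta_2}(\infty)=0$.
   Context: For a real number $\beta>1$, the $\beta$-transformation $T_\beta:[0,1]\to[0,1]$ is $T_\beta x=\beta x-\lfloor\beta x\rfloor$, and $T_\beta^n$ is its $n$-th iterate. $\mathbb N=\{1,2,\dots\}$, and $\dim_{\mathrm H}$ denotes Hausdorff dimension. For real $\beta_1,\beta_2>1$ and $(x,y)\in[0,1]^2$, the asymptotic approximation exponent is $$v_{\beta_1,\beta_2}(x,y)=\sup\{0\le v<\infty:\ T_{\beta_1}^nx<\beta_1^{-nv}\text{ and }T_{\beta_2}^ny<\beta_2^{-nv}\text{ for infinitely many }n\in\mathbb N\}\in[0,\infty].$$ For $v\in[0,\infty]$, $A_{\beta_1,\beta_2}(v)=\{(x,y)\in[0,1]^2:\ v_{\beta_1,\beta_2}(x,y)=v\}$. For $0<v<\infty$,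 $$W_{\beta_1,\beta_2}(v)=\{(x,y)\in[0,1]^2:\ T_{\beta_1}^nx<\beta_1^{-nv}\text{ and }T_{\beta_2}^ny<\beta_2^{-nv}\text{ for infinitely many }n\in\mathbb N\}.$$ *)

theory Defs
  imports "HOL-Analysis.Analysis"
begin

text \<open>The contribution \<open>(diam U)\<^sup>s\<close> of a covering set, with the usual conventions for empty
  sets and \<open>0\<^sup>0 = 1\<close>; the real power \<open>powr\<close> would give \<open>0 powr 0 = 0\<close>.\<close>

definition diam_pow :: "real \<Rightarrow> 'a::metric_space set \<Rightarrow> ennreal" where
  "diam_pow s U =
    (if U = {} then 0 else if s = 0 then 1 else ennreal (diameter U powr s))"

text \<open>Boundedness has to be required explicitly: \<^const>\<open>diameter\<close> is real-valued and carries no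
  information on unbounded sets.  Finite covers are included, since \<open>U i\<close> may be empty.\<close>

definition hausdorff_content :: "real \<Rightarrow> real \<Rightarrow> 'a::metric_space set \<Rightarrow> ennreal" where
  "hausdorff_content \<delta> s A =
    (INF U \<in> {U :: nat \<Rightarrow> 'a set.
                A \<subseteq> (\<Union>i. U i) \<and> (\<forall>i. bounded (U i) \<and> diameter (U i) \<le> \<delta>)}.
       \<Sum>i. diam_pow s (U i))"

definition hausdorff_measure :: "real \<Rightarrow> 'a::metric_space set \<Rightarrow> ennreal" where
  "hausdorff_measure s A = (SUP \<delta> \<in> {0<..}. hausdorff_content \<delta> s A)"

definition hausdorff_dim :: "'a::metric_space set \<Rightarrow> ereal" where
  "hausdorff_dim A = Inf {ereal s | s. 0 \<le> s \<and> hausdorff_measure s A = 0}"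

definition beta_map :: "real \<Rightarrow> real \<Rightarrow> real" where
  "beta_map \<beta> x = \<beta> * x - of_int \<lfloor>\<beta> * x\<rfloor>"

definition approx_io :: "real \<Rightarrow> real \<Rightarrow> real \<Rightarrow> real \<times> real \<Rightarrow> bool" where
  "approx_io \<beta>1 \<beta>2 v p \<longleftrightarrow>
    infinite {n::nat. 1 \<le> n
      \<and> (beta_map \<beta>1 ^^ n) (fst p) < \<beta>1 powr (- (real n * v))
      \<and> (beta_map \<beta>2 ^^ n) (snd p) < \<beta>2 powr (- (real n * v))}"

text \<open>For \<open>\<beta>1, \<beta>2 > 1\<close> the set below always contains \<open>0\<close>, because
  \<open>beta_map \<beta> x < 1\<close>; hence the supremum lies in \<open>[0, \<infinity>]\<close> and the convention
  for the supremum of the empty set plays no role.\<close>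

definition approx_exponent :: "real \<Rightarrow> real \<Rightarrow> real \<times> real \<Rightarrow> ereal" where
  "approx_exponent \<beta>1 \<beta>2 p = Sup {ereal v | v. 0 \<le> v \<and> approx_io \<beta>1 \<beta>2 v p}"

definition A_set :: "real \<Rightarrow> real \<Rightarrow> ereal \<Rightarrow> (real \<times> real) set" where
  "A_set \<beta>1 \<beta>2 v = {p \<in> {0..1} \<times> {0..1}. approx_exponent \<beta>1 \<beta>2 p = v}"

definition W_set :: "real \<Rightarrow> real \<Rightarrow> real \<Rightarrow> (real \<times> real) set" where
  "W_set \<beta>1 \<beta>2 v = {p \<in> {0..1} \<times> {0..1}. approx_io \<beta>1 \<beta>2 v p}"

definition dim_value :: "real \<Rightarrow> real \<Rightarrow> real \<Rightarrow> real" where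
  "dim_value \<beta>1 \<beta>2 v =
    (if \<beta>1 powr (1 + v) < \<beta>2
     then (2 + v - v * log \<beta>2 \<beta>1) / (1 + v)
     else min ((1 + log \<beta>2 \<beta>1) / ((1 + v) * log \<beta>2 \<beta>1))
              ((2 + v - v * log \<beta>2 \<beta>1) / (1 + v)))"

end

theory Submission
  imports Defs "HOL-Probability.Probability" "HOL-Real_Asymp.Real_Asymp"
begin

text \<open>
  Write \<open>t = log \<beta>2 \<beta>1 \<le> 1\<close> and \<open>u = 1 + v\<close>.  For every \<open>v \<ge> 0\<close> the claimed value is the minimum of
  \<open>(1 + t) / (u t)\<close> and \<open>(2 + v - v t) / u\<close>; under \<open>\<beta>1 powr u < \<beta>2\<close> the second number is the smaller
  one anyway (\<open>dim_value_eq_min\<close>).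

  Upper bound.  If \<open>T\<^sup>n x < \<beta> powr (- n v)\<close>, then \<open>x\<close> lies within \<open>\<beta> powr (- n u)\<close> of the left end of its
  cylinder of order \<open>n\<close>, and there are \<open>\<beta>\<^sup>n\<close> such cylinders up to a factor that is polynomial in \<open>n\<close>.
  Hence \<open>W(v)\<close> is contained in the limsup set of about \<open>(\<beta>1 \<beta>2)\<^sup>n\<close> rectangles with sides \<open>\<beta>1 powr (- n u)\<close> and
  \<open>\<beta>2 powr (- n u)\<close>.  Covering each of them by one square of its longer side gives the first number,
  and cutting it into squares of its shorter side gives the second (\<open>W_set_null\<close>).  The set \<open>A(v)\<close> is
  contained in \<open>W(v')\<close> for every \<open>v' < v\<close>, and the value is continuous in \<open>v\<close>.

  Lower bound.  Call a word full if its cylinder is mapped onto the whole unit interval.  Full words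
  of length \<open>m\<close> can be concatenated freely, and their number is at least \<open>\<beta>\<^sup>m / (m + 1)\<close>, so for large \<open>m\<close> they
  lose nothing in dimension.  Concatenate nonzero full words in both coordinates, except that all
  blocks with index in \<open>[K\<^sup>k, u K\<^sup>k]\<close> are zero, for \<open>k = 0, 1, 2, \<dots>\<close>.  At time \<open>m K\<^sup>k\<close> both orbits
  are as small as \<open>v\<close> demands, and at no time \<open>n\<close> is the first orbit essentially smaller than
  \<open>\<beta>1 powr (- n v)\<close>, so all these points belong to \<open>A(v) \<inter> W(v)\<close> (\<open>coded_point_exponent\<close>).  
  The product of the two uniform measures on the free digits gives to a set of diameter \<open>r\<close> a mass that is determined by the number of free blocks
  up to scale \<open>r\<close> in either coordinate.  A window costs most at one of the two scales where it ends,
  which are \<open>\<beta>1 powr (- n u)\<close> and \<open>\<beta>2 powr (- n u)\<close> for \<open>n = m K\<^sup>k\<close>, and these two scales account for the two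
  numbers in the minimum (\<open>window_mass_deficit\<close>).  Letting \<open>K\<close> and \<open>m\<close> grow, the mass distribution principle
  yields the bound (\<open>hausdorff_measure_A_W_positive\<close>).

  All of this works for \<open>v = 0\<close> as well, where the value is 2.  The set \<open>A(\<infinity>)\<close>
  is contained in \<open>W(v)\<close> for every finite \<open>v\<close>, and the value tends to 0 as \<open>v\<close> grows.
\<close>

section \<open>Hausdorff measures: covers and mass distributions\<close>

lemma diam_pow_pos_exponent: "0 < s \<Longrightarrow> diam_pow s U = ennreal (diameter U powr s)"
  by (simp add: diam_pow_def)

lemma hausdorff_content_le:
  assumes "A \<subseteq> (\<Union>i. U i)" "\<And>i::nat. bounded (U i) \<and> diameter (U i) \<le> \<delta>"
  shows "hausdorff_content \<delta> s A \<le> (\<Sum>i. diam_pow s (U i))"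
  unfolding hausdorff_content_def using assms by (intro INF_lower) auto

text \<open>A diameter of at most 1 is what makes the power decreasing in the exponent; for the exponent 0 it
  relies on the convention that a nonempty set contributes 1.\<close>

lemma diam_pow_antimono:
  assumes "0 \<le> s" "s \<le> s'" "bounded U" "diameter U \<le> 1"
  shows "diam_pow s' U \<le> diam_pow s U"
proof (cases "U = {} \<or> s' = 0")
  case True
  then show ?thesis using assms by (auto simp: diam_pow_def)
next
  case False
  have d0: "0 \<le> diameter U" using diameter_ge_0[OF assms(3)] .
  show ?thesis
  proof (cases "s = 0")
    case True
    have "diameter U powr s' \<le> 1"
      using d0 assms False powr_mono2[of s' "diameter U" 1] by simp
    then show ?thesis using False True by (simp add: diam_pow_def ennreal_le_1)
  next
    case s: False
    have "diameter U powr s' \<le> diameter U powr s"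
      using d0 assms by (intro powr_mono') auto
    then show ?thesis using False s by (simp add: diam_pow_def ennreal_leI)
  qed
qed

lemma hausdorff_measure_zero_mono:
  assumes "hausdorff_measure s A = 0" "0 \<le> s" "s \<le> s'"
  shows "hausdorff_measure s' A = 0"
proof -
  have small: "hausdorff_content \<delta> s' A = 0" if "0 < \<delta>" for \<delta>
  proof -
    define \<epsilon> where "\<epsilon> = min \<delta> 1"
    have e: "0 < \<epsilon>" "\<epsilon> \<le> 1" "\<epsilon> \<le> \<delta>" using that by (auto simp: \<epsilon>_def)
    have "hausdorff_content \<delta> s' A \<le> hausdorff_content \<epsilon> s A"
      unfolding hausdorff_content_def
    proof (rule INF_mono)
      fix U assume U: "U \<in> {U :: nat \<Rightarrow> 'a set. A \<subseteq> (\<Union>i. U i) \<and>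
          (\<forall>i. bounded (U i) \<and> diameter (U i) \<le> \<epsilon>)}"
      have "(\<Sum>i. diam_pow s' (U i)) \<le> (\<Sum>i. diam_pow s (U i))"
        using U e assms(2,3) by (intro suminf_le diam_pow_antimono) (auto intro: order_trans)
      then show "\<exists>V\<in>{U. A \<subseteq> (\<Union>i. U i) \<and> (\<forall>i. bounded (U i) \<and> diameter (U i) \<le> \<delta>)}.
          (\<Sum>i. diam_pow s' (V i)) \<le> (\<Sum>i. diam_pow s (U i))"
        using U e by (intro bexI[of _ U]) (auto intro: order_trans)
    qed
    also have "\<dots> \<le> hausdorff_measure s A"
      unfolding hausdorff_measure_def using e by (intro SUP_upper) auto
    finally show ?thesis using assms(1) by simp
  qed
  show ?thesis
    unfolding hausdorff_measure_def using small by (intro antisym SUP_least) auto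
qed

lemma hausdorff_measure_mono:
  assumes "A \<subseteq> B"
  shows "hausdorff_measure s A \<le> hausdorff_measure s B"
  unfolding hausdorff_measure_def hausdorff_content_def
  by (intro SUP_mono bexI[rotated] INF_superset_mono) (use assms in auto)

lemma hausdorff_dim_le:
  assumes "0 \<le> d" "\<And>s. d < s \<Longrightarrow> hausdorff_measure s A = 0"
  shows "hausdorff_dim A \<le> ereal d"
proof (rule ereal_le_epsilon2)
  fix e :: real assume "0 < e"
  then have "hausdorff_dim A \<le> ereal (d + e)"
    unfolding hausdorff_dim_def using assms by (intro Inf_lower) auto
  then show "hausdorff_dim A \<le> ereal d + ereal e" by simp
qed

lemma hausdorff_dim_ge:
  assumes "\<And>s. 0 < s \<Longrightarrow> s < d \<Longrightarrow> hausdorff_measure s A \<noteq> 0"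
  shows "ereal d \<le> hausdorff_dim A"
  unfolding hausdorff_dim_def
proof (rule Inf_greatest)
  fix x assume "x \<in> {ereal s |s. 0 \<le> s \<and> hausdorff_measure s A = 0}"
  then obtain s where s: "x = ereal s" "0 \<le> s" "hausdorff_measure s A = 0" by auto
  have "d \<le> s"
  proof (rule ccontr)
    assume "\<not> d \<le> s"
    then have "0 < (s + d) / 2" "(s + d) / 2 < d" "s \<le> (s + d) / 2" using s by auto
    then show False using assms hausdorff_measure_zero_mono[OF s(3,2)] by blast
  qed
  then show "ereal d \<le> x" using s by simp
qed

text \<open>The mass distribution principle.  A cover of \<open>A\<close> induces a cover of the whole probability space by
  the events \<open>E\<close>, whose total mass must be at least 1.  The measure lives on a parameter space of \<open>A\<close>, where the
  preimage of a small set can be enclosed in a finite union of cylinders.\<close>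

lemma hausdorff_measure_neq_0_mass_distribution:
  fixes X :: "'b \<Rightarrow> 'a::metric_space" and C s \<delta> :: real
  assumes M: "prob_space M" and s: "0 < s" and \<delta>: "0 < \<delta>" and C: "0 < C"
    and XA: "\<And>\<omega>. \<omega> \<in> space M \<Longrightarrow> X \<omega> \<in> A"
    and small: "\<And>S r. \<lbrakk>0 < r; r \<le> \<delta>; \<And>x y. x \<in> S \<Longrightarrow> y \<in> S \<Longrightarrow> dist x y \<le> r\<rbrakk> \<Longrightarrow>
      \<exists>E\<in>sets M. {\<omega> \<in> space M. X \<omega> \<in> S} \<subseteq> E \<and> emeasure M E \<le> ennreal (C * r powr s)"
  shows "hausdorff_measure s A \<noteq> 0"
proof
  interpret prob_space M by fact
  assume "hausdorff_measure s A = 0"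
  moreover have "hausdorff_content \<delta> s A \<le> hausdorff_measure s A"
    unfolding hausdorff_measure_def using \<delta> by (intro SUP_upper) auto
  ultimately have "hausdorff_content \<delta> s A < ennreal (1 / (4 * C))" using C by simp
  then obtain U :: "nat \<Rightarrow> 'a set" where U: "A \<subseteq> (\<Union>i. U i)"
      "\<And>i. bounded (U i)" "\<And>i. diameter (U i) \<le> \<delta>"
      and sumU: "(\<Sum>i. diam_pow s (U i)) < ennreal (1 / (4 * C))"
    unfolding hausdorff_content_def by (auto simp: INF_less_iff)
  have ex: "\<exists>E\<in>sets M. {\<omega> \<in> space M. X \<omega> \<in> U i} \<subseteq> E \<and>
      emeasure M E \<le> ennreal C * diam_pow s (U i) + ennreal ((1/2) ^ (i + 2))" for i
  proof (cases "diameter (U i) = 0")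
    case False
    then have pos: "0 < diameter (U i)" using diameter_ge_0[OF U(2)[of i]] by linarith
    obtain E where "E \<in> sets M" "{\<omega> \<in> space M. X \<omega> \<in> U i} \<subseteq> E"
        "emeasure M E \<le> ennreal (C * diameter (U i) powr s)"
      using small[OF pos U(3), of "U i"] diameter_bounded_bound[OF U(2)] by blast
    moreover have "ennreal (C * diameter (U i) powr s) = ennreal C * diam_pow s (U i)"
      using C s by (simp add: diam_pow_pos_exponent ennreal_mult)
    ultimately show ?thesis by (intro bexI[of _ E]) (auto intro: order_trans)
  next
    case True
    \<comment> \<open>a set of diameter zero is enlarged to a radius whose mass is negligible\<close>
    define r where "r = min \<delta> (((1/2) ^ (i + 2) / C) powr (1 / s))"
    have r: "0 < r" "r \<le> \<delta>" using \<delta> C by (auto simp: r_def)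
    have "r powr s \<le> (((1/2) ^ (i + 2) / C) powr (1 / s)) powr s"
      using r s by (intro powr_mono2) (auto simp: r_def)
    also have "\<dots> = (1/2) ^ (i + 2) / C" using s C by (simp add: powr_powr)
    finally have "C * r powr s \<le> (1/2) ^ (i + 2)" using C by (simp add: field_simps)
    moreover have "dist x y \<le> r" if "x \<in> U i" "y \<in> U i" for x y
      using diameter_bounded_bound[OF U(2) that] True r by simp
    then obtain E where E: "E \<in> sets M" "{\<omega> \<in> space M. X \<omega> \<in> U i} \<subseteq> E"
        and "emeasure M E \<le> ennreal (C * r powr s)"
      using small[OF r, of "U i"] by blast
    moreover have "ennreal (C * r powr s) \<le> ennreal ((1/2) ^ (i + 2))"
      using calculation(1) by (rule ennreal_leI)
    ultimately have "emeasure M E \<le> ennreal ((1/2) ^ (i + 2))" by (meson order_trans)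
    then show ?thesis using E by (intro bexI[of _ E] conjI add_increasing) auto
  qed
  have "\<exists>E. \<forall>i. E i \<in> sets M \<and> {\<omega> \<in> space M. X \<omega> \<in> U i} \<subseteq> E i \<and>
      emeasure M (E i) \<le> ennreal C * diam_pow s (U i) + ennreal ((1/2) ^ (i + 2))"
    by (rule choice, rule allI) (use ex in blast)
  then obtain E where E: "\<And>i. E i \<in> sets M" "\<And>i. {\<omega> \<in> space M. X \<omega> \<in> U i} \<subseteq> E i"
      "\<And>i. emeasure M (E i) \<le> ennreal C * diam_pow s (U i) + ennreal ((1/2) ^ (i + 2))"
    by blast
  have "space M \<subseteq> (\<Union>i. E i)"
  proof
    fix \<omega> assume w: "\<omega> \<in> space M"
    then obtain i where "X \<omega> \<in> U i" using U(1) XA by blast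
    then have "\<omega> \<in> E i" using w E(2)[of i] by blast
    then show "\<omega> \<in> (\<Union>i. E i)" by blast
  qed
  then have "emeasure M (space M) \<le> emeasure M (\<Union>i. E i)"
    using E(1) by (intro emeasure_mono) auto
  then have "1 \<le> emeasure M (\<Union>i. E i)" by (simp add: emeasure_space_1)
  also have "\<dots> \<le> (\<Sum>i. emeasure M (E i))"
    using E(1) by (intro emeasure_subadditive_countably) auto
  also have "\<dots> \<le> (\<Sum>i. ennreal C * diam_pow s (U i) + ennreal ((1/2) ^ (i + 2)))"
    using E(3) by (intro suminf_le) auto
  also have "\<dots> = ennreal C * (\<Sum>i. diam_pow s (U i)) + (\<Sum>i. ennreal ((1/2) ^ (i + 2)))"
    by (simp add: suminf_add[symmetric])
  also have "(\<Sum>i. ennreal ((1/2) ^ (i + 2))) = ennreal (1/2)"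
  proof (rule suminf_ennreal_eq)
    have "(\<lambda>i. (1/2::real)^2 * (1/2) ^ i) sums ((1/2)^2 * (1 / (1 - 1/2)))"
      by (intro sums_mult geometric_sums) auto
    then show "(\<lambda>i. (1/2::real) ^ (i + 2)) sums (1/2)"
      by (simp add: power_add power2_eq_square mult_ac)
  qed simp
  also have "ennreal C * (\<Sum>i. diam_pow s (U i)) \<le> ennreal C * ennreal (1 / (4 * C))"
    using sumU by (intro mult_left_mono) auto
  also have "ennreal C * ennreal (1 / (4 * C)) = ennreal (1/4)"
    using C by (simp add: ennreal_mult[symmetric])
  also have "ennreal (1/4) + ennreal (1/2) = ennreal (3/4)"
    by (subst ennreal_plus[symmetric]) auto
  finally show False by (simp flip: ennreal_1 add: ennreal_le_iff)
qed

text \<open>The convergence half of the Borel-Cantelli lemma for Hausdorff measures: a limsup set is covered by the tails of the family,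
  whose total contribution tends to zero.\<close>

lemma hausdorff_measure_0_covers:
  fixes A :: "'a::metric_space set" and V :: "nat \<Rightarrow> 'i \<Rightarrow> 'a set"
  assumes s: "0 < s"
    and cover: "\<And>x. x \<in> A \<Longrightarrow> infinite {n. \<exists>i\<in>I n. x \<in> V n i}"
    and fin: "\<And>n. finite (I n)"
    and diam: "\<And>n i. i \<in> I n \<Longrightarrow> bounded (V n i) \<and> diameter (V n i) \<le> d n"
    and d: "d \<longlonglongrightarrow> 0" "\<And>n. 0 \<le> d n"
    and sm: "summable (\<lambda>n. card (I n) * d n powr s)"
  shows "hausdorff_measure s A = 0"
proof -
  let ?c = "\<lambda>n. card (I n) * d n powr s"
  have bound: "hausdorff_content \<delta> s A \<le> ennreal e" if \<delta>: "0 < \<delta>" and e: "0 < e" for \<delta> e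
  proof -
    have "\<forall>\<^sub>F n in sequentially. d n < \<delta>" using d(1) \<delta> by (rule order_tendstoD)
    then obtain N1 where N1: "\<And>n. n \<ge> N1 \<Longrightarrow> d n < \<delta>" by (auto simp: eventually_sequentially)
    obtain N2 where N2: "\<And>n. n \<ge> N2 \<Longrightarrow> norm (\<Sum>i. ?c (i + n)) < e"
      using suminf_exist_split[OF e sm] by blast
    define N where "N = max N1 N2"
    have smN: "summable (\<lambda>n. ?c (n + N))" using summable_ignore_initial_segment[OF sm] .
    have "\<exists>f. bij_betw f {..<card (I n)} (I n)" for n
      using ex_bij_betw_nat_finite[OF fin, of n] by (simp add: atLeast0LessThan)
    then obtain f where f: "\<And>n. bij_betw (f n) {..<card (I n)} (I n)" by metis
    define U where "U = (\<lambda>n j. if j < card (I (n + N)) then V (n + N) (f (n + N) j) else {})"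
    have fI: "f n j \<in> I n" if "j < card (I n)" for n j
      using bij_betwE[OF f[of n]] that by auto
    have Ud: "bounded (U n j) \<and> diameter (U n j) \<le> d (n + N)" for n j
      using diam[OF fI] d(2) by (auto simp: U_def)
    have S1: "hausdorff_content \<delta> s A \<le> (\<Sum>i. diam_pow s ((\<lambda>(n, j). U n j) (prod_decode i)))"
    proof (rule hausdorff_content_le)
      show "A \<subseteq> (\<Union>i. (\<lambda>(n, j). U n j) (prod_decode i))"
      proof
        fix x assume "x \<in> A"
        then have "\<exists>n\<ge>N. \<exists>i\<in>I n. x \<in> V n i"
          using cover[of x] by (auto simp: infinite_nat_iff_unbounded_le)
        then obtain n i where ni: "n \<ge> N" "i \<in> I n" "x \<in> V n i" by blast
        have "i \<in> f n ` {..<card (I n)}"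
          using ni(2) bij_betw_imp_surj_on[OF f[of n]] by simp
        then obtain j where j: "j < card (I n)" "f n j = i" by auto
        have "x \<in> U (n - N) j" using ni j by (simp add: U_def)
        then have "x \<in> (\<lambda>(n, j). U n j) (prod_decode (prod_encode (n - N, j)))" by simp
        then show "x \<in> (\<Union>i. (\<lambda>(n, j). U n j) (prod_decode i))" by (rule UN_I[OF UNIV_I])
      qed
      show "bounded ((\<lambda>(n, j). U n j) (prod_decode i)) \<and>
          diameter ((\<lambda>(n, j). U n j) (prod_decode i)) \<le> \<delta>" for i
      proof -
        obtain n j where nj: "prod_decode i = (n, j)" by fastforce
        have "d (n + N) < \<delta>" by (rule N1) (simp add: N_def)
        then show ?thesis using Ud[of n j] by (simp add: nj)
      qed
    qed
    \<comment> \<open>the double sequence of covering sets is enumerated by a pairing function\<close>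
    have S2: "(\<Sum>i. diam_pow s ((\<lambda>(n, j). U n j) (prod_decode i))) = (\<Sum>n. \<Sum>j. diam_pow s (U n j))"
    proof (rule suminf_ennreal_2dimen[where f = "\<lambda>i. diam_pow s ((\<lambda>(n, j). U n j) i)", unfolded o_def])
      show "(\<Sum>j. diam_pow s (U n j)) = (\<Sum>j. diam_pow s ((\<lambda>(n, j). U n j) (n, j)))" for n
        by simp
    qed
    have S3: "(\<Sum>j. diam_pow s (U n j)) \<le> ennreal (?c (n + N))" for n
    proof -
      have "(\<Sum>j. diam_pow s (U n j)) = (\<Sum>j<card (I (n + N)). diam_pow s (U n j))"
        by (intro suminf_finite) (auto simp: U_def diam_pow_def)
      also have "\<dots> \<le> (\<Sum>j<card (I (n + N)). ennreal (d (n + N) powr s))"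
        using s Ud diameter_ge_0
        by (intro sum_mono) (auto simp: diam_pow_pos_exponent intro!: ennreal_leI powr_mono2)
      also have "\<dots> = ennreal (?c (n + N))"
        by (simp add: ennreal_mult ennreal_of_nat_eq_real_of_nat)
      finally show ?thesis .
    qed
    have S4: "(\<Sum>n. \<Sum>j. diam_pow s (U n j)) \<le> (\<Sum>n. ennreal (?c (n + N)))"
      by (rule suminf_le[OF S3 summableI summableI])
    have "hausdorff_content \<delta> s A \<le> (\<Sum>n. ennreal (?c (n + N)))"
      using S1 S4 unfolding S2 by (rule order_trans)
    also have "\<dots> = ennreal (\<Sum>n. ?c (n + N))"
      by (rule suminf_ennreal2[OF _ smN]) simp
    also have "\<dots> \<le> ennreal e"
      using N2[of N] by (simp add: N_def ennreal_leI)
    finally show ?thesis .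
  qed
  have "hausdorff_content \<delta> s A \<le> 0" if \<delta>: "0 < \<delta>" for \<delta>
  proof (rule ennreal_le_epsilon)
    fix e :: real assume "0 < e"
    from bound[OF \<delta> this] show "hausdorff_content \<delta> s A \<le> 0 + ennreal e" by simp
  qed
  then show ?thesis
    unfolding hausdorff_measure_def by (intro antisym SUP_least) auto
qed

section \<open>Cylinders of the beta-transformation\<close>

lemma beta_map_range: "0 \<le> beta_map \<beta> x" "beta_map \<beta> x < 1"
  unfolding beta_map_def by linarith+

lemma beta_map_small:
  assumes "0 \<le> \<beta> * x" "\<beta> * x < 1"
  shows "beta_map \<beta> x = \<beta> * x"
  using assms unfolding beta_map_def by (simp add: floor_eq_iff)

lemma beta_map_funpow_nonneg: "0 \<le> x \<Longrightarrow> 0 \<le> (beta_map \<beta> ^^ n) x"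
  using beta_map_range by (cases n) auto

lemma beta_map_funpow_less_1: "n \<noteq> 0 \<or> x < 1 \<Longrightarrow> (beta_map \<beta> ^^ n) x < 1"
  using beta_map_range by (cases n) auto

lemma beta_map_funpow_small:
  assumes "1 < \<beta>" "0 \<le> x" "\<beta> ^ n * x < 1"
  shows "(beta_map \<beta> ^^ n) x = \<beta> ^ n * x"
  using assms(3)
proof (induction n)
  case (Suc n)
  have "\<beta> ^ n * x \<le> \<beta> ^ Suc n * x" using assms by (intro mult_right_mono) auto
  then have IH: "(beta_map \<beta> ^^ n) x = \<beta> ^ n * x" using Suc by auto
  show ?case using Suc.prems assms IH by (simp add: beta_map_small mult.assoc)
qed simp

text \<open>The left end of the cylinder of order \<open>n\<close> around \<open>x\<close>, on which \<open>T\<^sup>n\<close> is affine with slope \<open>\<beta>\<^sup>n\<close> and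
  starts with the value 0.\<close>

definition cyl_left :: "real \<Rightarrow> nat \<Rightarrow> real \<Rightarrow> real" where
  "cyl_left \<beta> n x = x - (beta_map \<beta> ^^ n) x / \<beta> ^ n"

definition cyl_lefts :: "real \<Rightarrow> nat \<Rightarrow> real set" where
  "cyl_lefts \<beta> n = cyl_left \<beta> n ` {0..<1}"

text \<open>The left ends of the full cylinders of order \<open>n\<close>.  A cylinder is represented by this number
  instead of its word, so that concatenation of words becomes
  \<open>c + c' / \<beta>\<^sup>n\<close> and appending a zero changes nothing.\<close>

definition full_lefts :: "real \<Rightarrow> nat \<Rightarrow> real set" where
  "full_lefts \<beta> n = {c. 0 \<le> c \<and> c + 1 / \<beta> ^ n \<le> 1 \<and>
     (\<forall>z\<in>{0..<1}. (beta_map \<beta> ^^ n) (c + z / \<beta> ^ n) = z)}"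

text \<open>Rounding down in units of \<open>\<delta>\<close> is injective on a \<open>\<delta>\<close>-separated set.\<close>

lemma separated_card_le:
  fixes S :: "real set"
  assumes "0 < \<delta>" "S \<subseteq> {l..h}" "l \<le> h"
    and sep: "\<And>x y. x \<in> S \<Longrightarrow> y \<in> S \<Longrightarrow> x < y \<Longrightarrow> x + \<delta> \<le> y"
  shows "finite S \<and> real (card S) \<le> (h - l) / \<delta> + 1"
proof -
  define f where "f = (\<lambda>x. \<lfloor>(x - l) / \<delta>\<rfloor>)"
  have lt: "f x < f y" if "x \<in> S" "y \<in> S" "x < y" for x y
  proof -
    have "(x - l) / \<delta> + 1 \<le> (y - l) / \<delta>"
      using divide_right_mono[OF sep[OF that], of \<delta>] assms(1)
      by (simp add: add_divide_distrib diff_divide_distrib)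
    then show ?thesis unfolding f_def by linarith
  qed
  have inj: "inj_on f S"
    by (rule inj_onI) (metis lt less_irrefl linorder_less_linear)
  have sub: "f ` S \<subseteq> {0..\<lfloor>(h - l) / \<delta>\<rfloor>}"
    using assms(1,2) unfolding f_def
    by (auto intro!: floor_mono divide_right_mono simp: subset_iff)
  have fin: "finite S" using finite_imageD[OF finite_subset[OF sub] inj] by simp
  have "card S = card (f ` S)" using card_image[OF inj] by simp
  also have "\<dots> \<le> card {0..\<lfloor>(h - l) / \<delta>\<rfloor>}" using sub by (intro card_mono) auto
  finally have "card S \<le> nat (\<lfloor>(h - l) / \<delta>\<rfloor> + 1)" by simp
  moreover have "0 \<le> (h - l) / \<delta>" using assms by simp
  ultimately show ?thesis using fin by linarith
qed

text \<open>On a full cylinder \<open>T\<^sup>n\<close> vanishes at the left end only, so distinct full cylinders cannot overlap.\<close>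

lemma full_lefts_separated:
  assumes "1 < \<beta>" "c \<in> full_lefts \<beta> n" "c' \<in> full_lefts \<beta> n" "c < c'"
  shows "c + 1 / \<beta> ^ n \<le> c'"
proof (rule ccontr)
  assume "\<not> ?thesis"
  define z where "z = (c' - c) * \<beta> ^ n"
  have p: "0 < \<beta> ^ n" using assms by simp
  have "c' - c < 1 / \<beta> ^ n" using \<open>\<not> _\<close> by simp
  then have z: "0 < z" "z < 1"
    using assms(4) p by (auto simp: z_def pos_less_divide_eq)
  have "(beta_map \<beta> ^^ n) (c + z / \<beta> ^ n) = z"
    using assms(2) z unfolding full_lefts_def by auto
  moreover have "c + z / \<beta> ^ n = c' + 0 / \<beta> ^ n" using assms(1) by (simp add: z_def)
  moreover have "(beta_map \<beta> ^^ n) (c' + 0 / \<beta> ^ n) = 0"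
    using assms(3) unfolding full_lefts_def by fastforce
  ultimately show False using z by simp
qed

lemma card_full_lefts_le:
  assumes "1 < \<beta>"
  shows "finite (full_lefts \<beta> n)" "real (card (full_lefts \<beta> n)) \<le> \<beta> ^ n"
proof -
  have p: "1 \<le> \<beta> ^ n" using assms by (intro one_le_power) auto
  then have p0: "0 < \<beta> ^ n" by linarith
  have "finite (full_lefts \<beta> n) \<and>
      real (card (full_lefts \<beta> n)) \<le> ((1 - 1 / \<beta> ^ n) - 0) / (1 / \<beta> ^ n) + 1"
    using p p0 full_lefts_separated[OF assms]
    by (intro separated_card_le) (auto simp: full_lefts_def)
  moreover have "((1 - 1 / \<beta> ^ n) - 0) / (1 / \<beta> ^ n) + 1 = \<beta> ^ n"
    using p0 assms by (simp add: field_simps)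
  ultimately show "finite (full_lefts \<beta> n)" "real (card (full_lefts \<beta> n)) \<le> \<beta> ^ n"
    by auto
qed

lemma zero_in_full_lefts:
  assumes "1 < \<beta>"
  shows "0 \<in> full_lefts \<beta> n"
proof -
  have "1 \<le> \<beta> ^ n" using assms by (intro one_le_power) auto
  then have "1 / \<beta> ^ n \<le> 1" "0 < \<beta> ^ n" by (auto simp: field_simps)
  then show ?thesis
    using assms by (auto simp: full_lefts_def beta_map_funpow_small)
qed

text \<open>A full word followed by the digit 0 is full, because \<open>T\<close> maps \<open>[0, 1 / \<beta>)\<close> onto the unit
  interval.\<close>

lemma full_lefts_Suc:
  assumes "1 < \<beta>"
  shows "full_lefts \<beta> n \<subseteq> full_lefts \<beta> (Suc n)"
proof
  fix c assume c: "c \<in> full_lefts \<beta> n"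
  have p: "0 < \<beta> ^ n" using assms by simp
  have "1 / \<beta> ^ Suc n \<le> 1 / \<beta> ^ n" using assms by (intro divide_left_mono) auto
  moreover have "(beta_map \<beta> ^^ Suc n) (c + z / \<beta> ^ Suc n) = z" if z: "z \<in> {0..<1}" for z
  proof -
    have "z / \<beta> < 1" using z assms by (auto simp: field_simps)
    then have "z / \<beta> \<in> {0..<1}" using z assms by auto
    then have "(beta_map \<beta> ^^ n) (c + (z / \<beta>) / \<beta> ^ n) = z / \<beta>"
      using c unfolding full_lefts_def by blast
    then show ?thesis using z assms by (simp add: beta_map_small)
  qed
  ultimately show "c \<in> full_lefts \<beta> (Suc n)" using c unfolding full_lefts_def by auto
qed

text \<open>Every point between the left end of a cylinder and \<open>x\<close> has the same first \<open>n\<close> digits as \<open>x\<close>: the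
  greedy expansion does not change its digits when the remainder is lowered.\<close>

lemma beta_map_funpow_cyl:
  assumes "1 < \<beta>" "x \<in> {0..<1}" "0 \<le> z" "z \<le> (beta_map \<beta> ^^ n) x"
  shows "(beta_map \<beta> ^^ n) (cyl_left \<beta> n x + z / \<beta> ^ n) = z"
  using assms(3,4)
proof (induction n arbitrary: z)
  case (Suc n)
  define w where "w = (beta_map \<beta> ^^ n) x"
  define d where "d = of_int \<lfloor>\<beta> * w\<rfloor> + (0::real)"
  have w0: "0 \<le> w" using assms(2) by (simp add: w_def beta_map_funpow_nonneg)
  have d0: "0 \<le> d" using w0 assms(1) by (simp add: d_def)
  have T: "(beta_map \<beta> ^^ Suc n) x = \<beta> * w - d" by (simp add: w_def d_def beta_map_def)
  have p: "0 < \<beta> ^ n" "0 < \<beta>" using assms by auto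
  have "(d + z) / \<beta> \<le> w" using Suc.prems(2)[unfolded T] p by (simp add: field_simps)
  then have IH: "(beta_map \<beta> ^^ n) (cyl_left \<beta> n x + ((d + z) / \<beta>) / \<beta> ^ n) = (d + z) / \<beta>"
    using Suc.IH[of "(d + z) / \<beta>"] Suc.prems d0 p by (simp add: w_def)
  have eq: "cyl_left \<beta> (Suc n) x + z / \<beta> ^ Suc n = cyl_left \<beta> n x + ((d + z) / \<beta>) / \<beta> ^ n"
    using p unfolding cyl_left_def T by (simp add: w_def[symmetric] field_simps)
  have "z < 1" using Suc.prems(2) beta_map_funpow_less_1[of "Suc n" x \<beta>] by linarith
  then have "beta_map \<beta> ((d + z) / \<beta>) = z"
    using Suc.prems(1) p by (simp add: beta_map_def d_def floor_eq_iff)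
  then show ?case using IH unfolding eq by simp
qed (simp add: cyl_left_def)

lemma cyl_left_Suc:
  assumes "0 < \<beta>"
  shows "cyl_left \<beta> (Suc n) x = cyl_left \<beta> n x + \<lfloor>\<beta> * (beta_map \<beta> ^^ n) x\<rfloor> / \<beta> ^ Suc n"
  using assms unfolding cyl_left_def by (simp add: beta_map_def field_simps)

lemma cyl_left_nonneg:
  assumes "0 < \<beta>" "0 \<le> x"
  shows "0 \<le> cyl_left \<beta> n x"
proof (induction n)
  case (Suc n)
  have "0 \<le> \<lfloor>\<beta> * (beta_map \<beta> ^^ n) x\<rfloor>"
    using assms beta_map_funpow_nonneg[of x n \<beta>] by simp
  then show ?case using Suc assms by (simp add: cyl_left_Suc)
qed (simp add: cyl_left_def)

text \<open>If the last digit of a word is not 0, then lowering it by 1 gives a full word, as the cylinder of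
  the lowered word is bounded on the right by another cylinder with the same parent.  This is what
  bounds the number of all words by the number of full ones.\<close>

lemma cyl_left_Suc_cases:
  assumes "1 < \<beta>" "x \<in> {0..<1}"
  shows "cyl_left \<beta> (Suc n) x \<in> cyl_lefts \<beta> n \<or>
    cyl_left \<beta> (Suc n) x - 1 / \<beta> ^ Suc n \<in> full_lefts \<beta> (Suc n)"
proof -
  define w where "w = (beta_map \<beta> ^^ n) x"
  define d where "d = \<lfloor>\<beta> * w\<rfloor>"
  have w: "0 \<le> w" using assms(2) by (simp add: w_def beta_map_funpow_nonneg)
  have p: "0 < \<beta> ^ n" "0 < \<beta>" using assms by auto
  have d0: "0 \<le> d" using w assms(1) by (simp add: d_def)
  have dw: "real_of_int d \<le> \<beta> * w" by (simp add: d_def)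
  have eq: "cyl_left \<beta> (Suc n) x = cyl_left \<beta> n x + d / \<beta> ^ Suc n"
    using p by (simp add: cyl_left_Suc w_def d_def)
  show ?thesis
  proof (cases "d = 0")
    case True
    then show ?thesis using eq assms(2) by (auto simp: cyl_lefts_def)
  next
    case False
    then have d1: "1 \<le> d" using d0 by simp
    let ?c = "cyl_left \<beta> (Suc n) x - 1 / \<beta> ^ Suc n"
    have c: "?c + z / \<beta> ^ Suc n = cyl_left \<beta> n x + ((d - 1 + z) / \<beta>) / \<beta> ^ n"
      for z :: real
      unfolding eq using p by (simp add: field_simps)
    have "0 \<le> cyl_left \<beta> n x" using cyl_left_nonneg assms p by simp
    then have "0 \<le> ?c" using c[of 0] d1 p by simp
    moreover have "?c + 1 / \<beta> ^ Suc n \<le> 1"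
    proof -
      have "0 \<le> (beta_map \<beta> ^^ Suc n) x / \<beta> ^ Suc n"
        using assms p beta_map_funpow_nonneg[of x "Suc n" \<beta>] by (intro divide_nonneg_pos) auto
      then show ?thesis using assms(2) unfolding cyl_left_def by auto
    qed
    moreover have "(beta_map \<beta> ^^ Suc n) (?c + z / \<beta> ^ Suc n) = z" if "z \<in> {0..<1}" for z
    proof -
      have "(d - 1 + z) / \<beta> \<le> w" using dw that p by (auto simp: field_simps)
      moreover have "0 \<le> (d - 1 + z) / \<beta>" using d1 that p by simp
      ultimately have "(beta_map \<beta> ^^ n) (?c + z / \<beta> ^ Suc n) = (d - 1 + z) / \<beta>"
        unfolding c w_def by (intro beta_map_funpow_cyl[OF assms])
      then have "(beta_map \<beta> ^^ Suc n) (?c + z / \<beta> ^ Suc n) = beta_map \<beta> ((d - 1 + z) / \<beta>)"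
        by simp
      also have "\<dots> = z" using that p by (simp add: beta_map_def floor_eq_iff)
      finally show ?thesis .
    qed
    ultimately show ?thesis unfolding full_lefts_def by auto
  qed
qed

text \<open>Each order contributes at most as many new left ends as it has full words, and the number of full
  words increases with the order.\<close>

lemma card_cyl_lefts_le:
  assumes "1 < \<beta>"
  shows "finite (cyl_lefts \<beta> n) \<and> card (cyl_lefts \<beta> n) \<le> Suc n * card (full_lefts \<beta> n)"
proof (induction n)
  case 0
  have "cyl_lefts \<beta> 0 \<subseteq> {0}" by (auto simp: cyl_lefts_def cyl_left_def)
  moreover have "card (full_lefts \<beta> 0) \<noteq> 0"
    using zero_in_full_lefts[OF assms] card_full_lefts_le(1)[OF assms] by auto
  ultimately show ?case
    using finite_subset[of _ "{0::real}"] card_mono[of "{0::real}" "cyl_lefts \<beta> 0"]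
    by fastforce
next
  case (Suc n)
  let ?F = "full_lefts \<beta> (Suc n)" and ?g = "\<lambda>c. c + 1 / \<beta> ^ Suc n"
  have "e \<in> cyl_lefts \<beta> n \<union> ?g ` ?F" if "e \<in> cyl_lefts \<beta> (Suc n)" for e
  proof -
    have "e \<in> cyl_lefts \<beta> n \<or> e - 1 / \<beta> ^ Suc n \<in> ?F"
      using that cyl_left_Suc_cases[OF assms] unfolding cyl_lefts_def by blast
    then show ?thesis by (auto intro!: rev_image_eqI[of "e - 1 / \<beta> ^ Suc n"])
  qed
  then have sub: "cyl_lefts \<beta> (Suc n) \<subseteq> cyl_lefts \<beta> n \<union> ?g ` ?F" by blast
  have fin: "finite ?F" using card_full_lefts_le(1)[OF assms] .
  have "card (cyl_lefts \<beta> (Suc n)) \<le> card (cyl_lefts \<beta> n \<union> ?g ` ?F)"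
    using sub Suc fin by (intro card_mono) auto
  also have "\<dots> \<le> card (cyl_lefts \<beta> n) + card ?F"
    using card_Un_le[of "cyl_lefts \<beta> n" "?g ` ?F"] card_image_le[OF fin, of ?g] by linarith
  also have "\<dots> \<le> Suc n * card ?F + card ?F"
  proof -
    have "card (full_lefts \<beta> n) \<le> card ?F"
      using full_lefts_Suc[OF assms] fin by (intro card_mono)
    then have "Suc n * card (full_lefts \<beta> n) \<le> Suc n * card ?F" by (rule mult_le_mono2)
    then show ?thesis using Suc by linarith
  qed
  finally show ?case using finite_subset[OF sub] Suc fin by simp
qed

lemma mem_cylinder:
  assumes "1 < \<beta>" "x \<in> {0..<1}"
  shows "x \<in> {cyl_left \<beta> n x ..< cyl_left \<beta> n x + 1 / \<beta> ^ n}"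
  using assms beta_map_funpow_nonneg[of x n \<beta>] beta_map_funpow_less_1[of n x \<beta>]
  by (auto simp: cyl_left_def divide_strict_right_mono)

text \<open>The cylinders of order \<open>n\<close> cover the unit interval and have length at most \<open>1 / \<beta>\<^sup>n\<close>, so there are at
  least \<open>\<beta>\<^sup>n\<close> of them, and at most \<open>n + 1\<close> times as many as full words.\<close>

lemma card_full_lefts_ge:
  assumes "1 < \<beta>"
  shows "\<beta> ^ n \<le> (real n + 1) * card (full_lefts \<beta> n)"
proof -
  let ?E = "cyl_lefts \<beta> n"
  have p: "0 < \<beta> ^ n" using assms by simp
  have finE: "finite ?E" using card_cyl_lefts_le[OF assms] by blast
  have "{0..<1} \<subseteq> (\<Union>c\<in>?E. {c..<c + 1 / \<beta> ^ n})"
    using mem_cylinder[OF assms] unfolding cyl_lefts_def by blast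
  then have "emeasure lborel {0..<1::real} \<le> emeasure lborel (\<Union>c\<in>?E. {c..<c + 1 / \<beta> ^ n})"
    using finE by (intro emeasure_mono) auto
  also have "\<dots> \<le> (\<Sum>c\<in>?E. emeasure lborel {c..<c + 1 / \<beta> ^ n})"
    using finE by (intro emeasure_subadditive_finite) auto
  also have "\<dots> = ennreal (card ?E * (1 / \<beta> ^ n))"
    using p by (simp add: ennreal_mult[symmetric] ennreal_of_nat_eq_real_of_nat)
  finally have "ennreal 1 \<le> ennreal (card ?E * (1 / \<beta> ^ n))" by simp
  then have "1 \<le> card ?E * (1 / \<beta> ^ n)" using p by (subst (asm) ennreal_le_iff) auto
  then have "\<beta> ^ n \<le> card ?E" using p by (simp add: field_simps)
  also have "\<dots> \<le> real (Suc n * card (full_lefts \<beta> n))"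
    using card_cyl_lefts_le[OF assms] by (simp only: of_nat_le_iff)
  finally show ?thesis by (simp add: algebra_simps)
qed

lemma card_cyl_lefts_le_power:
  assumes "1 < \<beta>"
  shows "real (card (cyl_lefts \<beta> n)) \<le> (real n + 1) * \<beta> ^ n"
proof -
  have "real (card (cyl_lefts \<beta> n)) \<le> real (Suc n * card (full_lefts \<beta> n))"
    using card_cyl_lefts_le[OF assms] by (simp only: of_nat_le_iff)
  also have "\<dots> \<le> (real n + 1) * \<beta> ^ n"
    using mult_left_mono[OF card_full_lefts_le(2)[OF assms, of n], of "real n + 1"]
    by (simp add: algebra_simps)
  finally show ?thesis .
qed

section \<open>The upper bound\<close>

lemma approx_io_mono:
  assumes "1 < \<beta>1" "1 < \<beta>2" "v \<le> v'" "approx_io \<beta>1 \<beta>2 v' p"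
  shows "approx_io \<beta>1 \<beta>2 v p"
proof -
  have le: "\<beta> powr (- (real n * v')) \<le> \<beta> powr (- (real n * v))" if "1 < \<beta>" for \<beta> n
    using that assms(3) by (intro powr_mono) (auto simp: mult_left_mono)
  show ?thesis
    using assms(4) le[OF assms(1)] le[OF assms(2)] unfolding approx_io_def
    by (elim infinite_super[rotated]) (auto intro: less_le_trans)
qed

lemma approx_io_0:
  assumes "1 < \<beta>1" "1 < \<beta>2"
  shows "approx_io \<beta>1 \<beta>2 0 p"
proof -
  have "{n::nat. 1 \<le> n \<and> (beta_map \<beta>1 ^^ n) (fst p) < \<beta>1 powr (- (real n * 0))
      \<and> (beta_map \<beta>2 ^^ n) (snd p) < \<beta>2 powr (- (real n * 0))} = {1..}"
    using assms by (auto simp: beta_map_funpow_less_1)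
  then show ?thesis unfolding approx_io_def by (simp add: infinite_Ici)
qed

lemma A_set_subset_W_set:
  assumes "1 < \<beta>1" "1 < \<beta>2" "v' \<le> 0 \<or> ereal v' < v"
  shows "A_set \<beta>1 \<beta>2 v \<subseteq> W_set \<beta>1 \<beta>2 v'"
proof
  fix p assume p: "p \<in> A_set \<beta>1 \<beta>2 v"
  have "\<exists>w\<ge>v'. approx_io \<beta>1 \<beta>2 w p"
    using assms(3)
  proof
    assume "v' \<le> 0"
    then show ?thesis using approx_io_0[OF assms(1,2)] by blast
  next
    assume "ereal v' < v"
    then have "ereal v' < Sup {ereal w | w. 0 \<le> w \<and> approx_io \<beta>1 \<beta>2 w p}"
      using p by (simp add: A_set_def approx_exponent_def)
    then obtain w where "approx_io \<beta>1 \<beta>2 w p" "v' < w" by (auto simp: less_Sup_iff)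
    then show ?thesis by (intro exI[of _ w]) auto
  qed
  then show "p \<in> W_set \<beta>1 \<beta>2 v'"
    using p approx_io_mono[OF assms(1,2)] by (auto simp: A_set_def W_set_def)
qed

text \<open>The point 1 belongs to no cylinder of \<open>[0, 1)\<close> and contributes one more left end.\<close>

definition closed_cyl_lefts :: "real \<Rightarrow> nat \<Rightarrow> real set" where
  "closed_cyl_lefts \<beta> n = cyl_left \<beta> n ` {0..1}"

lemma card_closed_cyl_lefts_le:
  assumes "1 < \<beta>"
  shows "finite (closed_cyl_lefts \<beta> n)" "real (card (closed_cyl_lefts \<beta> n)) \<le> (real n + 2) * \<beta> ^ n"
proof -
  have "{0..1::real} = insert 1 {0..<1}" by auto
  then have eq: "closed_cyl_lefts \<beta> n = insert (cyl_left \<beta> n 1) (cyl_lefts \<beta> n)"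
    unfolding closed_cyl_lefts_def cyl_lefts_def by simp
  show "finite (closed_cyl_lefts \<beta> n)" using card_cyl_lefts_le[OF assms] eq by simp
  have "real (card (closed_cyl_lefts \<beta> n)) \<le> real (card (cyl_lefts \<beta> n)) + 1"
    using card_cyl_lefts_le[OF assms, of n] by (simp add: eq card_insert_if)
  also have "\<dots> \<le> (real n + 1) * \<beta> ^ n + \<beta> ^ n"
    using card_cyl_lefts_le_power[OF assms, of n] one_le_power[of \<beta> n] assms by linarith
  finally show "real (card (closed_cyl_lefts \<beta> n)) \<le> (real n + 2) * \<beta> ^ n"
    by (simp add: algebra_simps)
qed

lemma summable_poly_geometric:
  fixes c :: real
  assumes "c < 0"
  shows "summable (\<lambda>n. (real n + 2) ^ 2 * exp (real n * c))"
proof (rule summable_comparison_test_ev)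
  show "\<forall>\<^sub>F n in sequentially. norm ((real n + 2) ^ 2 * exp (real n * c)) \<le> exp (c / 2) ^ n"
  proof -
    have "\<forall>\<^sub>F n in sequentially. (real n + 2) ^ 2 * exp (real n * c) \<le> exp (real n * (c / 2))"
      using assms by real_asymp
    then show ?thesis by (simp flip: exp_of_nat_mult)
  qed
  show "summable (\<lambda>n. exp (c / 2) ^ n)" using assms by (intro summable_geometric) auto
qed

lemma diameter_Times_le:
  fixes a b c d h :: real
  assumes "0 \<le> h" "b - a \<le> h" "d - c \<le> h"
  shows "bounded ({a..b} \<times> {c..d}) \<and> diameter ({a..b} \<times> {c..d}) \<le> 2 * h"
proof
  show "bounded ({a..b} \<times> {c..d})" by (intro bounded_Times) auto
  show "diameter ({a..b} \<times> {c..d}) \<le> 2 * h"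
  proof (rule diameter_le)
    show "{a..b} \<times> {c..d} \<noteq> {} \<or> 0 \<le> 2 * h" using assms by simp
    fix p q assume "p \<in> {a..b} \<times> {c..d}" "q \<in> {a..b} \<times> {c..d}"
    then have "dist (fst p) (fst q) \<le> h" "dist (snd p) (snd q) \<le> h"
      using assms by (auto simp: dist_real_def)
    then have "dist p q \<le> h + h"
      unfolding dist_prod_def by (intro order_trans[OF sqrt_sum_squares_le_sum]) auto
    then show "norm (p - q) \<le> 2 * h" by (simp add: dist_norm)
  qed
qed

text \<open>The number \<open>\<gamma>\<close> selects the side \<open>\<gamma> powr (- n u)\<close> of the covering squares.  The hypothesis on \<open>s\<close> says
  that the exponential growth rate of the number of squares, which is \<open>\<beta>1 \<beta>2 (\<gamma> / \<beta>1) powr u\<close>, is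
  beaten by the decay of their diameters to the power \<open>s\<close>.\<close>

lemma W_set_null:
  fixes \<beta>1 \<beta>2 \<gamma> s v :: real
  assumes "1 < \<beta>1" "\<beta>1 \<le> \<gamma>" "\<gamma> \<le> \<beta>2" "0 \<le> v" "0 < s"
    and s: "ln \<beta>1 + ln \<beta>2 + (1 + v) * (ln \<gamma> - ln \<beta>1) < (1 + v) * ln \<gamma> * s"
  shows "hausdorff_measure s (W_set \<beta>1 \<beta>2 v) = 0"
proof -
  define u where "u = 1 + v"
  define h where "h = (\<lambda>n::nat. exp (- (real n * u * ln \<gamma>)))"
  \<comment> \<open>index of the last of the squares into which a rectangle is cut along its first side\<close>
  define J where "J = (\<lambda>n::nat. nat \<lfloor>exp (real n * u * (ln \<gamma> - ln \<beta>1))\<rfloor>)"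
  define I where "I = (\<lambda>n. (closed_cyl_lefts \<beta>1 n \<times> closed_cyl_lefts \<beta>2 n) \<times> {0..J n})"
  define V where "V = (\<lambda>n ((c1, c2), j::nat).
      {c1 + real j * h n .. c1 + (real j + 1) * h n} \<times> {c2 .. c2 + h n :: real})"
  have b2: "1 < \<beta>2" and g: "1 < \<gamma>" using assms by auto
  have logs: "0 < ln \<beta>1" "ln \<beta>1 \<le> ln \<gamma>" "ln \<gamma> \<le> ln \<beta>2" using assms by auto
  have u: "1 \<le> u" using assms by (simp add: u_def)
  have h0: "0 < h n" for n by (simp add: h_def)
  have pw: "\<beta> ^ n = exp (real n * ln \<beta>)" if "1 < \<beta>" for \<beta> and n :: nat
    using that by (simp add: exp_of_nat_mult)
  have rect: "(beta_map \<beta> ^^ n) x / \<beta> ^ n \<le> exp (- (real n * u * ln \<beta>))"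
    if "1 < \<beta>" "(beta_map \<beta> ^^ n) x < \<beta> powr (- (real n * v))" for \<beta> n x
  proof -
    have "(beta_map \<beta> ^^ n) x / \<beta> ^ n \<le> \<beta> powr (- (real n * v)) / \<beta> ^ n"
      using that by (intro divide_right_mono) auto
    also have "\<dots> = exp (- (real n * u * ln \<beta>))"
      using that by (simp add: pw powr_def exp_diff[symmetric] u_def algebra_simps)
    finally show ?thesis .
  qed
  show ?thesis
  proof (rule hausdorff_measure_0_covers[where I = I and V = V and d = "\<lambda>n. 2 * h n"])
    show "finite (I n)" for n
      using card_closed_cyl_lefts_le(1)[OF assms(1)] card_closed_cyl_lefts_le(1)[OF b2]
      by (auto simp: I_def)
    show "bounded (V n i) \<and> diameter (V n i) \<le> 2 * h n" if "i \<in> I n" for n i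
    proof -
      obtain c1 c2 j where i: "i = ((c1, c2), j)" by (metis surj_pair)
      show ?thesis
        unfolding i V_def prod.case using h0[of n]
        by (intro diameter_Times_le) (auto simp: algebra_simps)
    qed
    show "0 \<le> 2 * h n" for n using h0[of n] by simp
    define k where "k = u * ln \<gamma>"
    have "0 < k" using u logs by (simp add: k_def)
    then have "(\<lambda>n. 2 * exp (- (real n * k))) \<longlonglongrightarrow> 0" by real_asymp
    then show "(\<lambda>n. 2 * h n) \<longlonglongrightarrow> 0" by (simp add: h_def k_def mult.assoc)
    show "infinite {n. \<exists>i\<in>I n. p \<in> V n i}" if p: "p \<in> W_set \<beta>1 \<beta>2 v" for p
    proof (rule infinite_super)
      show "infinite {n::nat. 1 \<le> n
        \<and> (beta_map \<beta>1 ^^ n) (fst p) < \<beta>1 powr (- (real n * v))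
        \<and> (beta_map \<beta>2 ^^ n) (snd p) < \<beta>2 powr (- (real n * v))}"
        using p by (simp add: W_set_def approx_io_def)
      show "{n::nat. 1 \<le> n
        \<and> (beta_map \<beta>1 ^^ n) (fst p) < \<beta>1 powr (- (real n * v))
        \<and> (beta_map \<beta>2 ^^ n) (snd p) < \<beta>2 powr (- (real n * v))}
          \<subseteq> {n. \<exists>i\<in>I n. p \<in> V n i}"
      proof (intro subsetI CollectI)
        fix n assume "n \<in> {n::nat. 1 \<le> n
        \<and> (beta_map \<beta>1 ^^ n) (fst p) < \<beta>1 powr (- (real n * v))
        \<and> (beta_map \<beta>2 ^^ n) (snd p) < \<beta>2 powr (- (real n * v))}"
        then have n: "(beta_map \<beta>1 ^^ n) (fst p) < \<beta>1 powr (- (real n * v))"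
          "(beta_map \<beta>2 ^^ n) (snd p) < \<beta>2 powr (- (real n * v))" by auto
        have p01: "fst p \<in> {0..1}" "snd p \<in> {0..1}" using p by (auto simp: W_set_def)
        define c1 where "c1 = cyl_left \<beta>1 n (fst p)"
        define c2 where "c2 = cyl_left \<beta>2 n (snd p)"
        define y where "y = fst p - c1"
        define j where "j = nat \<lfloor>y / h n\<rfloor>"
        have "y \<le> exp (- (real n * u * ln \<beta>1))"
          using rect[OF assms(1) n(1)] by (simp add: y_def c1_def cyl_left_def)
        then have "y / h n \<le> exp (- (real n * u * ln \<beta>1)) / h n"
          using h0[of n] by (intro divide_right_mono) auto
        also have "\<dots> = exp (real n * u * (ln \<gamma> - ln \<beta>1))"
          by (simp add: h_def exp_diff[symmetric] algebra_simps)
        finally have "j \<le> J n" unfolding j_def J_def by (intro nat_mono floor_mono)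
        moreover have y0: "0 \<le> y"
          using p01 beta_map_funpow_nonneg[of "fst p" n \<beta>1] assms(1)
          by (simp add: y_def c1_def cyl_left_def)
        then have "0 \<le> y / h n" using h0[of n] by simp
        then have "real j \<le> y / h n" "y / h n \<le> real j + 1" unfolding j_def by linarith+
        then have "real j * h n \<le> y" "y \<le> (real j + 1) * h n"
          using h0[of n] by (auto simp: field_simps)
        moreover have "snd p - c2 \<le> h n"
        proof -
          have "snd p - c2 \<le> exp (- (real n * u * ln \<beta>2))"
            using rect[OF b2 n(2)] by (simp add: c2_def cyl_left_def)
          also have "\<dots> \<le> h n" using u logs by (simp add: h_def mult_left_mono)
          finally show ?thesis .
        qed
        moreover have "c2 \<le> snd p"
          using p01 beta_map_funpow_nonneg[of "snd p" n \<beta>2] b2 by (simp add: c2_def cyl_left_def)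
        ultimately have "p \<in> V n ((c1, c2), j)" "((c1, c2), j) \<in> I n"
          using p01 by (auto simp: V_def I_def mem_Times_iff y_def c1_def c2_def closed_cyl_lefts_def)
        then show "\<exists>i\<in>I n. p \<in> V n i" by blast
      qed
    qed
    define c where "c = ln \<beta>1 + ln \<beta>2 + u * (ln \<gamma> - ln \<beta>1) - u * ln \<gamma> * s"
    have c: "c < 0" using s by (simp add: c_def u_def)
    show "summable (\<lambda>n. real (card (I n)) * (2 * h n) powr s)"
    proof (rule summable_comparison_test')
      show "summable (\<lambda>n. 2 * 2 powr s * ((real n + 2) ^ 2 * exp (real n * c)))"
        by (intro summable_mult summable_poly_geometric c)
      fix n :: nat
      let ?e = "exp (real n * u * (ln \<gamma> - ln \<beta>1))"
      have "1 \<le> ?e" using u logs by simp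
      then have Je: "real (J n) + 1 \<le> 2 * ?e" unfolding J_def by linarith
      have "real (card (I n)) = real (card (closed_cyl_lefts \<beta>1 n)) * real (card (closed_cyl_lefts \<beta>2 n))
          * (real (J n) + 1)"
        by (simp add: I_def card_cartesian_product algebra_simps)
      also have "\<dots> \<le> ((real n + 2) * \<beta>1 ^ n) * ((real n + 2) * \<beta>2 ^ n) * (2 * ?e)"
        using card_closed_cyl_lefts_le(2)[OF assms(1)] card_closed_cyl_lefts_le(2)[OF b2] Je assms(1) b2
        by (intro mult_mono) auto
      also have "\<dots> = 2 * (real n + 2) ^ 2 *
          exp (real n * (ln \<beta>1 + ln \<beta>2 + u * (ln \<gamma> - ln \<beta>1)))"
        by (simp add: pw[OF assms(1)] pw[OF b2] exp_add ring_distribs power2_eq_square mult_ac)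
      finally have cI: "real (card (I n)) \<le> 2 * (real n + 2) ^ 2 *
          exp (real n * (ln \<beta>1 + ln \<beta>2 + u * (ln \<gamma> - ln \<beta>1)))" .
      have "(2 * h n) powr s = 2 powr s * exp (- (real n * (u * ln \<gamma> * s)))"
        by (simp add: powr_mult h_def exp_powr_real mult_ac)
      then have "real (card (I n)) * (2 * h n) powr s \<le> (2 * (real n + 2) ^ 2 *
          exp (real n * (ln \<beta>1 + ln \<beta>2 + u * (ln \<gamma> - ln \<beta>1)))) *
          (2 powr s * exp (- (real n * (u * ln \<gamma> * s))))"
        using cI by (simp add: mult_right_mono)
      also have "\<dots> = 2 * 2 powr s * ((real n + 2) ^ 2 * exp (real n * c))"
      proof -
        have "exp (real n * c) = exp (real n * (ln \<beta>1 + ln \<beta>2 + u * (ln \<gamma> - ln \<beta>1))) *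
            exp (- (real n * (u * ln \<gamma> * s)))"
          unfolding c_def exp_add[symmetric] by (simp add: right_diff_distrib)
        then show ?thesis by (simp only: mult_ac)
      qed
      finally show "norm (real (card (I n)) * (2 * h n) powr s) \<le>
          2 * 2 powr s * ((real n + 2) ^ 2 * exp (real n * c))" by simp
    qed
  qed fact
qed

section \<open>Numbers coded by separated digits\<close>

text \<open>The number with digits \<open>\<omega>\<close> in base \<open>1 / \<rho>\<close>, where the first digit has weight 1.  For \<open>\<rho> = 1 / \<beta>\<^sup>m\<close> and
  digits in \<open>full_lefts \<beta> m\<close> it is the point whose beta-expansion is the concatenation of these full
  words, provided that all tails of the series are below 1.\<close>

definition coded :: "real \<Rightarrow> (nat \<Rightarrow> real) \<Rightarrow> real" where
  "coded \<rho> \<omega> = (\<Sum>i. \<omega> i * \<rho> ^ i)"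

definition code_prefix :: "real \<Rightarrow> nat \<Rightarrow> (nat \<Rightarrow> real) \<Rightarrow> real" where
  "code_prefix \<rho> q \<omega> = (\<Sum>i<q. \<omega> i * \<rho> ^ i)"

lemma summable_coded:
  fixes \<rho> :: real
  assumes "0 < \<rho>" "\<rho> < 1" "\<And>i. \<omega> i \<in> {0..1 - \<rho>}"
  shows "summable (\<lambda>i. \<omega> i * \<rho> ^ i)"
proof (rule summable_comparison_test'[where N = 0])
  show "summable (\<lambda>i. (1 - \<rho>) * \<rho> ^ i)" using assms by (intro summable_mult summable_geometric) auto
  show "norm (\<omega> i * \<rho> ^ i) \<le> (1 - \<rho>) * \<rho> ^ i" for i
    using assms(1) assms(3)[of i] by (auto simp: abs_mult mult_right_mono)
qed

lemma coded_bounds: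
  assumes "0 < \<rho>" "\<rho> < 1" "\<And>i. \<omega> i \<in> {0..1 - \<rho>}"
  shows "coded \<rho> \<omega> \<in> {0..1}"
proof -
  have s: "(\<lambda>i. (1 - \<rho>) * \<rho> ^ i) sums ((1 - \<rho>) * (1 / (1 - \<rho>)))"
    using assms by (intro sums_mult geometric_sums) auto
  have "coded \<rho> \<omega> \<le> (\<Sum>i. (1 - \<rho>) * \<rho> ^ i)"
    unfolding coded_def using assms(1,2) assms(3)
    by (intro suminf_le summable_coded sums_summable[OF s]) (auto simp: mult_right_mono)
  also have "\<dots> = 1" using sums_unique[OF s] assms by simp
  finally have "coded \<rho> \<omega> \<le> 1" .
  moreover have "0 \<le> coded \<rho> \<omega>"
    unfolding coded_def using assms by (intro suminf_nonneg summable_coded) auto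
  ultimately show ?thesis by simp
qed

lemma coded_shift:
  assumes "0 < \<rho>" "\<rho> < 1" "\<And>i. \<omega> i \<in> {0..1 - \<rho>}"
  shows "coded \<rho> \<omega> = code_prefix \<rho> q \<omega> + \<rho> ^ q * coded \<rho> (\<lambda>i. \<omega> (i + q))"
proof -
  have s: "summable (\<lambda>i. \<omega> (i + q) * \<rho> ^ i)" by (rule summable_coded) (use assms in auto)
  have "coded \<rho> \<omega> = (\<Sum>i. \<omega> (i + q) * \<rho> ^ (i + q)) + code_prefix \<rho> q \<omega>"
    unfolding coded_def code_prefix_def by (rule suminf_split_initial_segment[OF summable_coded[OF assms]])
  also have "(\<Sum>i. \<omega> (i + q) * \<rho> ^ (i + q)) = (\<Sum>i. \<rho> ^ q * (\<omega> (i + q) * \<rho> ^ i))"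
    by (simp add: power_add mult_ac)
  also have "\<dots> = \<rho> ^ q * coded \<rho> (\<lambda>i. \<omega> (i + q))"
    unfolding coded_def by (rule suminf_mult[OF s])
  finally show ?thesis by simp
qed

lemma code_prefix_Suc: "code_prefix \<rho> (Suc q) \<omega> = code_prefix \<rho> q \<omega> + \<omega> q * \<rho> ^ q"
  by (simp add: code_prefix_def)

lemma code_prefix_le:
  assumes "0 < \<rho>" "\<And>i. \<omega> i \<in> {0..1 - \<rho>}"
  shows "code_prefix \<rho> q \<omega> \<le> 1 - \<rho> ^ q"
proof (induction q)
  case (Suc q)
  have "\<omega> q * \<rho> ^ q \<le> (1 - \<rho>) * \<rho> ^ q" using assms by (intro mult_right_mono) auto
  then show ?case using Suc by (simp add: code_prefix_Suc algebra_simps)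
qed (simp add: code_prefix_def)

text \<open>The value 1 is only attained if all digits are equal to \<open>1 - \<rho>\<close>.  A tail equal to 1 would carry over
  into the preceding word, and the orbit would no longer follow the digits.\<close>

lemma coded_less_1:
  assumes "0 < \<rho>" "\<rho> < 1" "\<And>i. \<omega> i \<in> {0..1 - \<rho>}" "\<omega> k = 0"
  shows "coded \<rho> \<omega> < 1"
proof -
  have "coded \<rho> \<omega> = code_prefix \<rho> (Suc k) \<omega> + \<rho> ^ Suc k * coded \<rho> (\<lambda>i. \<omega> (i + Suc k))"
    by (rule coded_shift[OF assms(1-3)])
  also have "code_prefix \<rho> (Suc k) \<omega> \<le> 1 - \<rho> ^ k"
    using code_prefix_le[of \<rho> \<omega> k] assms by (simp add: code_prefix_Suc)
  also have "\<rho> ^ Suc k * coded \<rho> (\<lambda>i. \<omega> (i + Suc k)) \<le> \<rho> ^ Suc k * 1"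
    using coded_bounds[of \<rho> "\<lambda>i. \<omega> (i + Suc k)"] assms by (intro mult_left_mono) auto
  also have "\<rho> ^ Suc k * 1 < \<rho> ^ k" using assms by simp
  finally show ?thesis by simp
qed

locale separated_digits =
  fixes \<rho> :: real and F :: "real set"
  assumes rho: "0 < \<rho>" "\<rho> < 1" and F_sub: "F \<subseteq> {0..1 - \<rho>}" and F_fin: "finite F"
    and F_sep: "\<And>a b. a \<in> F \<Longrightarrow> b \<in> F \<Longrightarrow> a < b \<Longrightarrow> a + \<rho> \<le> b"
begin

lemma digit_bounds: "range \<omega> \<subseteq> F \<Longrightarrow> \<omega> i \<in> {0..1 - \<rho>}"
  using F_sub by blast

text \<open>The digits following a position of order \<open>i\<close> contribute less than the gap \<open>\<rho> * \<rho>\<^sup>i\<close> between two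
  distinct digits there, with \<open>\<rho>\<^sup>q\<close> to spare.\<close>

lemma code_prefix_separated:
  assumes "range \<omega> \<subseteq> F" "range \<omega>' \<subseteq> F" "code_prefix \<rho> q \<omega> < code_prefix \<rho> q \<omega>'"
  shows "code_prefix \<rho> q \<omega> + \<rho> ^ q \<le> code_prefix \<rho> q \<omega>'"
  using assms
proof (induction q arbitrary: \<omega> \<omega>')
  case (Suc q)
  have r: "0 < \<rho> ^ q" using rho by simp
  \<comment> \<open>once the prefixes differ, no later digits can exhaust the gap between them\<close>
  have step: "code_prefix \<rho> (Suc q) \<alpha> + \<rho> ^ Suc q \<le> code_prefix \<rho> (Suc q) \<alpha>'"
    if "range \<alpha> \<subseteq> F" "range \<alpha>' \<subseteq> F" "code_prefix \<rho> q \<alpha> < code_prefix \<rho> q \<alpha>'" for \<alpha> \<alpha>'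
  proof -
    have "\<alpha> q * \<rho> ^ q \<le> (1 - \<rho>) * \<rho> ^ q" "0 \<le> \<alpha>' q * \<rho> ^ q"
      using digit_bounds[OF that(1), of q] digit_bounds[OF that(2), of q] r
      by (auto intro: mult_right_mono)
    then show ?thesis using Suc.IH[OF that] by (simp add: code_prefix_Suc algebra_simps)
  qed
  consider "code_prefix \<rho> q \<omega> < code_prefix \<rho> q \<omega>'" | "code_prefix \<rho> q \<omega>' < code_prefix \<rho> q \<omega>"
    | "code_prefix \<rho> q \<omega> = code_prefix \<rho> q \<omega>'" by linarith
  then show ?case
  proof cases
    case 1
    then show ?thesis using step Suc.prems by blast
  next
    case 2
    then have "code_prefix \<rho> (Suc q) \<omega>' + \<rho> ^ Suc q \<le> code_prefix \<rho> (Suc q) \<omega>"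
      using step Suc.prems by blast
    moreover have "0 < \<rho> ^ Suc q" using rho by simp
    ultimately show ?thesis using Suc.prems(3) by linarith
  next
    case 3
    then have "\<omega> q < \<omega>' q" using Suc.prems(3) r by (simp add: code_prefix_Suc)
    then have "\<omega> q + \<rho> \<le> \<omega>' q" using F_sep Suc.prems by blast
    then have "(\<omega> q + \<rho>) * \<rho> ^ q \<le> \<omega>' q * \<rho> ^ q" using r by (intro mult_right_mono) auto
    then show ?thesis using 3 by (simp add: code_prefix_Suc algebra_simps)
  qed
qed (simp add: code_prefix_def)

lemma code_prefix_inj:
  assumes "range \<omega> \<subseteq> F" "range \<omega>' \<subseteq> F" "code_prefix \<rho> q \<omega> = code_prefix \<rho> q \<omega>'" "i < q"
  shows "\<omega> i = \<omega>' i"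
  using assms(3,4)
proof (induction q)
  case (Suc q)
  have r: "0 < \<rho> ^ q" using rho by simp
  have le: "code_prefix \<rho> q \<alpha>' \<le> code_prefix \<rho> q \<alpha>"
    if "range \<alpha> \<subseteq> F" "range \<alpha>' \<subseteq> F" "code_prefix \<rho> (Suc q) \<alpha> = code_prefix \<rho> (Suc q) \<alpha>'" for \<alpha> \<alpha>'
  proof (rule ccontr)
    assume "\<not> ?thesis"
    then have "code_prefix \<rho> q \<alpha> + \<rho> ^ q \<le> code_prefix \<rho> q \<alpha>'" using code_prefix_separated that by simp
    moreover have "\<alpha> q * \<rho> ^ q \<le> (1 - \<rho>) * \<rho> ^ q" "0 \<le> \<alpha>' q * \<rho> ^ q"
      using digit_bounds[OF that(1), of q] digit_bounds[OF that(2), of q] r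
      by (auto intro: mult_right_mono)
    moreover have "0 < \<rho> * \<rho> ^ q" using rho by simp
    ultimately show False using that(3) by (simp add: code_prefix_Suc algebra_simps)
  qed
  have eq: "code_prefix \<rho> q \<omega> = code_prefix \<rho> q \<omega>'"
    using le[OF assms(1,2) Suc.prems(1)] le[OF assms(2,1) Suc.prems(1)[symmetric]] by simp
  then have "\<omega> q = \<omega>' q" using Suc.prems(1) rho by (simp add: code_prefix_Suc)
  then show ?case using Suc.IH[OF eq] Suc.prems(2) by (cases "i = q") auto
qed simp

text \<open>A set of diameter at most \<open>\<rho>\<^sup>q\<close> meets the intervals of length \<open>\<rho>\<^sup>q\<close> belonging to at most four prefixes of
  length \<open>q\<close>: their left ends lie in an interval of length \<open>3 * \<rho>\<^sup>q\<close> and are separated by \<open>\<rho>\<^sup>q\<close>.\<close>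

lemma coded_small_set_measure:
  fixes D :: "nat \<Rightarrow> real set"
  assumes D: "\<And>i. D i \<subseteq> F" "\<And>i. D i \<noteq> {}"
    and S: "\<And>x y. x \<in> S \<Longrightarrow> y \<in> S \<Longrightarrow> \<bar>x - y\<bar> \<le> \<rho> ^ q"
  defines "M \<equiv> PiM UNIV (\<lambda>i. uniform_count_measure (D i))"
  shows "\<exists>E\<in>sets M. {\<omega> \<in> space M. coded \<rho> \<omega> \<in> S} \<subseteq> E \<and>
    emeasure M E \<le> ennreal (4 * (\<Prod>i<q. 1 / real (card (D i))))"
proof -
  have D_fin: "finite (D i)" for i using D(1) F_fin by (rule finite_subset)
  interpret product_prob_space "\<lambda>i. uniform_count_measure (D i)" UNIV
    by (intro product_prob_spaceI prob_space_uniform_count_measure D_fin D)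
  have space: "\<omega> \<in> space M \<longleftrightarrow> (\<forall>i. \<omega> i \<in> D i)" for \<omega>
    by (simp add: M_def space_PiM space_uniform_count_measure PiE_UNIV_domain Pi_iff)
  have rng: "range \<omega> \<subseteq> F" if "\<omega> \<in> space M" for \<omega> using that D(1) space by blast
  define W where "W = {\<omega> \<in> space M. coded \<rho> \<omega> \<in> S}"
  define cyl where "cyl = (\<lambda>\<omega>0. {\<omega> \<in> space M. \<forall>i\<in>{..<q}. \<omega> i \<in> {\<omega>0 i}})"
  have cyl_sets: "cyl \<omega>0 \<in> sets M"
    and cyl_measure: "emeasure M (cyl \<omega>0) = ennreal (\<Prod>i<q. 1 / real (card (D i)))"
    if "\<omega>0 \<in> space M" for \<omega>0
  proof -
    have d: "\<omega>0 i \<in> D i" for i using that space by blast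
    show "cyl \<omega>0 \<in> sets M"
      unfolding cyl_def M_def using d
      by (intro sets.sets_Collect_finite_All sets_Collect_single)
        (auto simp: sets_uniform_count_measure)
    have "emeasure M (cyl \<omega>0) = (\<Prod>i<q. emeasure (uniform_count_measure (D i)) {\<omega>0 i})"
      unfolding cyl_def M_def using d
      by (intro emeasure_PiM_Collect) (auto simp: sets_uniform_count_measure)
    also have "\<dots> = (\<Prod>i<q. ennreal (1 / real (card (D i))))"
      using d D_fin by (intro prod.cong) (auto simp: emeasure_uniform_count_measure)
    also have "\<dots> = ennreal (\<Prod>i<q. 1 / real (card (D i)))" by (intro prod_ennreal) auto
    finally show "emeasure M (cyl \<omega>0) = ennreal (\<Prod>i<q. 1 / real (card (D i)))" .
  qed
  have card4: "finite (code_prefix \<rho> q ` W) \<and> real (card (code_prefix \<rho> q ` W)) \<le> 4"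
  proof (cases "W = {}")
    case False
    then obtain \<omega>0 where w0: "\<omega>0 \<in> W" by blast
    define x where "x = coded \<rho> \<omega>0"
    have r: "0 < \<rho> ^ q" using rho by simp
    have sub: "code_prefix \<rho> q ` W \<subseteq> {x - 2 * \<rho> ^ q .. x + \<rho> ^ q}"
    proof (rule image_subsetI)
      fix \<omega> assume w: "\<omega> \<in> W"
      then have b: "\<omega> i \<in> {0..1 - \<rho>}" for i
        using digit_bounds[OF rng] by (simp add: W_def)
      have "coded \<rho> (\<lambda>i. \<omega> (i + q)) \<in> {0..1}" using b rho by (intro coded_bounds) auto
      then have "0 \<le> \<rho> ^ q * coded \<rho> (\<lambda>i. \<omega> (i + q))"
        "\<rho> ^ q * coded \<rho> (\<lambda>i. \<omega> (i + q)) \<le> \<rho> ^ q * 1"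
        using r by (auto intro!: mult_left_mono simp del: mult_1_right)
      moreover have "coded \<rho> \<omega> = code_prefix \<rho> q \<omega> + \<rho> ^ q * coded \<rho> (\<lambda>i. \<omega> (i + q))"
        by (rule coded_shift[OF rho b])
      moreover have "\<bar>coded \<rho> \<omega> - x\<bar> \<le> \<rho> ^ q"
        using S[of "coded \<rho> \<omega>" x] w w0 by (simp add: W_def x_def)
      ultimately show "code_prefix \<rho> q \<omega> \<in> {x - 2 * \<rho> ^ q .. x + \<rho> ^ q}" by auto
    qed
    have "a + \<rho> ^ q \<le> b"
      if ab: "a \<in> code_prefix \<rho> q ` W" "b \<in> code_prefix \<rho> q ` W" "a < b" for a b
    proof -
      obtain \<omega> \<omega>' where "\<omega> \<in> space M" "\<omega>' \<in> space M"
          and eq: "a = code_prefix \<rho> q \<omega>" "b = code_prefix \<rho> q \<omega>'"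
        using ab(1,2) by (auto simp: W_def)
      then show ?thesis using ab(3) code_prefix_separated[OF rng rng] by simp
    qed
    then have "finite (code_prefix \<rho> q ` W) \<and>
      real (card (code_prefix \<rho> q ` W)) \<le> ((x + \<rho> ^ q) - (x - 2 * \<rho> ^ q)) / \<rho> ^ q + 1"
      using r by (intro separated_card_le[OF r sub]) auto
    then show ?thesis using rho by simp
  qed simp
  define P where "P = code_prefix \<rho> q ` W"
  have P: "finite P" "real (card P) \<le> 4" using card4 by (auto simp: P_def)
  define rep where "rep = (\<lambda>c. SOME \<omega>. \<omega> \<in> W \<and> code_prefix \<rho> q \<omega> = c)"
  have rep: "rep c \<in> W" "code_prefix \<rho> q (rep c) = c" if "c \<in> P" for c
  proof -
    have "\<exists>\<omega>. \<omega> \<in> W \<and> code_prefix \<rho> q \<omega> = c" using that by (auto simp: P_def)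
    then have "rep c \<in> W \<and> code_prefix \<rho> q (rep c) = c" unfolding rep_def by (rule someI_ex)
    then show "rep c \<in> W" "code_prefix \<rho> q (rep c) = c" by auto
  qed
  have repM: "rep c \<in> space M" if "c \<in> P" for c using rep(1)[OF that] by (simp add: W_def)
  define E where "E = (\<Union>c\<in>P. cyl (rep c))"
  have "W \<subseteq> E"
  proof
    fix \<omega> assume w: "\<omega> \<in> W"
    define c where "c = code_prefix \<rho> q \<omega>"
    have c: "c \<in> P" using w by (simp add: P_def c_def)
    have wM: "\<omega> \<in> space M" using w by (simp add: W_def)
    have "\<omega> i = rep c i" if "i < q" for i
      using code_prefix_inj[OF rng[OF wM] rng[OF repM[OF c]] _ that] rep(2)[OF c] by (simp add: c_def)
    then show "\<omega> \<in> E" using c wM by (auto simp: E_def cyl_def)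
  qed
  moreover have "E \<in> sets M" unfolding E_def using P(1) cyl_sets repM by (intro sets.finite_UN) auto
  moreover have "emeasure M E \<le> ennreal (4 * (\<Prod>i<q. 1 / real (card (D i))))"
  proof -
    have "emeasure M E \<le> (\<Sum>c\<in>P. emeasure M (cyl (rep c)))"
      unfolding E_def using P(1) cyl_sets repM by (intro emeasure_subadditive_finite) auto
    also have "\<dots> = (\<Sum>c\<in>P. ennreal (\<Prod>i<q. 1 / real (card (D i))))"
      using cyl_measure repM by (intro sum.cong) auto
    also have "\<dots> = ennreal (real (card P) * (\<Prod>i<q. 1 / real (card (D i))))"
      by (simp add: ennreal_mult ennreal_of_nat_eq_real_of_nat prod_nonneg)
    also have "\<dots> \<le> ennreal (4 * (\<Prod>i<q. 1 / real (card (D i))))"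
      using P(2) by (intro ennreal_leI mult_right_mono prod_nonneg) auto
    finally show ?thesis .
  qed
  ultimately show ?thesis unfolding W_def by blast
qed

end

section \<open>Sparse windows of zeros\<close>

text \<open>The positions of the zero blocks.  The summand 1 puts \<open>K\<^sup>k\<close> itself into its window even if
  \<open>v = 0\<close>, so that there are infinitely many zero blocks in every case.\<close>

definition windows :: "nat \<Rightarrow> real \<Rightarrow> nat set" where
  "windows K v = {q. \<exists>k. K ^ k \<le> q \<and> real q < (1 + v) * real (K ^ k) + 1}"

text \<open>The word 0 is excluded from the free blocks to prevent an orbit from being small outside of the
  windows.\<close>

definition gap_digits :: "real \<Rightarrow> nat \<Rightarrow> nat set \<Rightarrow> nat \<Rightarrow> real set" where
  "gap_digits \<beta> m Z i = (if i \<in> Z then {0} else full_lefts \<beta> m - {0})"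

lemma power_in_windows:
  assumes "0 \<le> v"
  shows "K ^ k \<in> windows K v"
  using assms unfolding windows_def
  by (auto intro!: exI[of _ k] add_nonneg_pos simp: distrib_right)

text \<open>A window that starts at \<open>K\<^sup>k\<close> is left at about \<open>(1 + v) K\<^sup>k\<close>, before the next one starts.  This
  bounds the run of zeros ahead of any position by \<open>v\<close> times the position, up to a constant.\<close>

lemma next_free_position:
  assumes "0 \<le> v" "v + 4 \<le> real K"
  obtains q' where "q \<le> q'" "q' \<notin> windows K v" "real q' \<le> (1 + v) * real q + 2"
proof (cases "q \<in> windows K v")
  case False
  then show ?thesis using that[of q] assms by (simp add: algebra_simps)
next
  case True
  then obtain k where k: "K ^ k \<le> q" "real q < (1 + v) * real (K ^ k) + 1"
    unfolding windows_def by auto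
  define w where "w = (1 + v) * real (K ^ k) + 1"
  define q' where "q' = nat \<lceil>w\<rceil>"
  have w0: "0 \<le> w" using assms by (simp add: w_def)
  have K2: "2 \<le> K" using assms by linarith
  have q': "w \<le> real q'" "real q' < w + 1" using w0 unfolding q'_def by linarith+
  have "q' \<notin> windows K v"
  proof
    assume "q' \<in> windows K v"
    then obtain j where j: "K ^ j \<le> q'" "real q' < (1 + v) * real (K ^ j) + 1"
      unfolding windows_def by auto
    have "k < j"
    proof (rule ccontr)
      assume "\<not> k < j"
      then have "real (K ^ j) \<le> real (K ^ k)"
        using K2 by (simp only: of_nat_le_iff) (intro power_increasing, auto)
      then have "(1 + v) * real (K ^ j) \<le> (1 + v) * real (K ^ k)"
        using assms by (intro mult_left_mono) auto
      then show False using j(2) q'(1) by (simp add: w_def)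
    qed
    then have "K ^ Suc k \<le> K ^ j" using K2 by (intro power_increasing) auto
    then have "real (K ^ Suc k) \<le> real q'" using j(1) by (simp only: of_nat_le_iff)
    moreover have "(v + 4) * real (K ^ k) \<le> real K * real (K ^ k)"
      using assms by (intro mult_right_mono) auto
    moreover have "1 \<le> real (K ^ k)" using K2 by simp
    ultimately show False using q'(2) by (simp add: w_def algebra_simps)
  qed
  moreover have "q \<le> q'" using k(2) q'(1) by (simp add: w_def)
  moreover have "real q' \<le> (1 + v) * real q + 2"
  proof -
    have "(1 + v) * real (K ^ k) \<le> (1 + v) * real q"
      using assms k(1) by (intro mult_left_mono) (auto simp flip: of_nat_power)
    then show ?thesis using q'(2) by (simp add: w_def)
  qed
  ultimately show ?thesis using that by blast
qed

lemma card_nat_interval_le: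
  fixes A :: nat and B :: real
  shows "finite {q. A \<le> q \<and> real q < B}"
    and "real (card {q. A \<le> q \<and> real q < B}) \<le> max 0 (B - real A) + 1"
proof -
  have sub: "{q. A \<le> q \<and> real q < B} \<subseteq> {A..<nat \<lceil>B\<rceil>}"
    by (auto simp: less_ceiling_iff zless_nat_eq_int_zless)
  then show "finite {q. A \<le> q \<and> real q < B}" by (rule finite_subset) simp
  have "card {q. A \<le> q \<and> real q < B} \<le> nat \<lceil>B\<rceil> - A"
    using card_mono[OF _ sub] by simp
  then show "real (card {q. A \<le> q \<and> real q < B}) \<le> max 0 (B - real A) + 1" by linarith
qed

text \<open>At a scale comparable to \<open>K\<^sup>k\<close>, the windows before the one at \<open>K\<^sup>k\<close> have a total length of
  order \<open>K\<^sup>k / (K - 1)\<close>, a negligible fraction of \<open>Q\<close> for large \<open>K\<close>.  The parameter \<open>\<tau>\<close> allows \<open>Q\<close> to lie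
  somewhat below \<open>K\<^sup>k\<close>, because one radius is read off at different positions in the two coordinates.\<close>

lemma card_windows_below:
  fixes Q \<tau> v :: real
  assumes v: "0 \<le> v" and K: "2 \<le> K" and \<tau>: "0 < \<tau>"
    and Q: "\<tau> * real (K ^ k) \<le> Q" "Q < real (K ^ Suc k)"
  shows "real (card {q \<in> windows K v. real q < Q}) \<le>
    (v + 2) / (\<tau> * (real K - 1)) * Q + max 0 (min (Q - real (K ^ k)) (v * real (K ^ k))) + 2"
proof -
  define P where "P = real (K ^ k)"
  define A where "A = (\<lambda>j. {q. K ^ j \<le> q \<and> real q < (1 + v) * real (K ^ j) + 1})"
  define B where "B = {q. K ^ k \<le> q \<and> real q < min Q ((1 + v) * P + 1)}"
  have finA: "finite (A j)" for j unfolding A_def by (rule card_nat_interval_le)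
  have sub: "{q \<in> windows K v. real q < Q} \<subseteq> (\<Union>j<k. A j) \<union> B"
  proof
    fix q assume "q \<in> {q \<in> windows K v. real q < Q}"
    then obtain j where j: "K ^ j \<le> q" "real q < (1 + v) * real (K ^ j) + 1" "real q < Q"
      unfolding windows_def by auto
    have "real (K ^ j) \<le> real q" using j(1) by (simp only: of_nat_le_iff)
    then have "real (K ^ j) < real (K ^ Suc k)" using j(3) Q(2) by linarith
    then have "K ^ j < K ^ Suc k" by (simp only: of_nat_less_iff)
    then have "j < Suc k" by (rule power_less_imp_less_exp[rotated]) (use K in simp)
    then show "q \<in> (\<Union>j<k. A j) \<union> B"
      using j by (cases "j = k") (auto simp: A_def B_def P_def)
  qed
  have "card {q \<in> windows K v. real q < Q} \<le> card ((\<Union>j<k. A j) \<union> B)"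
    using sub finA card_nat_interval_le(1) by (intro card_mono) (auto simp del: min_less_iff_conj simp: B_def)
  also have "\<dots> \<le> card (\<Union>j<k. A j) + card B" by (rule card_Un_le)
  also have "\<dots> \<le> (\<Sum>j<k. card (A j)) + card B" using card_UN_le[of "{..<k}" A] by simp
  finally have 1: "real (card {q \<in> windows K v. real q < Q}) \<le>
      (\<Sum>j<k. real (card (A j))) + real (card B)" by (simp flip: of_nat_sum of_nat_add)
  have "real (card (A j)) \<le> (v + 2) * real K ^ j" for j
  proof -
    have "real (card (A j)) \<le> max 0 (((1 + v) * real (K ^ j) + 1) - real (K ^ j)) + 1"
      unfolding A_def by (rule card_nat_interval_le)
    also have "\<dots> = v * real K ^ j + 2" using v by (simp add: algebra_simps)
    also have "\<dots> \<le> (v + 2) * real K ^ j"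
      using one_le_power[of "real K" j] K by (simp add: algebra_simps)
    finally show ?thesis .
  qed
  then have "(\<Sum>j<k. real (card (A j))) \<le> (v + 2) * (\<Sum>j<k. real K ^ j)"
    unfolding sum_distrib_left by (intro sum_mono)
  also have "(\<Sum>j<k. real K ^ j) \<le> P / (real K - 1)"
    using K by (simp add: geometric_sum P_def divide_right_mono)
  also have "P / (real K - 1) \<le> (Q / \<tau>) / (real K - 1)"
    using Q(1) \<tau> K by (intro divide_right_mono) (auto simp: P_def field_simps)
  also have "(v + 2) * ((Q / \<tau>) / (real K - 1)) = (v + 2) / (\<tau> * (real K - 1)) * Q"
    by simp
  finally have 2: "(\<Sum>j<k. real (card (A j))) \<le> (v + 2) / (\<tau> * (real K - 1)) * Q"
    using v by (simp add: mult_left_mono)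
  have "real (card B) \<le> max 0 (min Q ((1 + v) * P + 1) - real (K ^ k)) + 1"
    unfolding B_def by (rule card_nat_interval_le)
  also have "\<dots> \<le> max 0 (min (Q - P) (v * P)) + 2"
    by (auto simp: P_def algebra_simps max_def min_def)
  finally show ?thesis using 1 2 by (simp add: P_def)
qed

text \<open>The optimisation behind the formula.  At a radius \<open>r\<close> the digits of the first coordinate are known up
  to position \<open>Q\<close> and those of the second up to \<open>t * Q\<close>, and a second digit weighs \<open>1 / t\<close> times as much as a first
  one.  The left side is the loss caused by the window \<open>[P, u * P]\<close> in both coordinates.  Relative to
  \<open>Q\<close>, it is largest where the window ends, at \<open>Q = u * P\<close> or at \<open>t * Q = u * P\<close>; the four cases say on
  which sides of the ends and the start of the window the two positions lie.\<close>

lemma window_mass_deficit: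
  fixes P Q t v :: real
  assumes "0 \<le> v" "0 < t" "t \<le> 1" "0 < P" "P \<le> Q"
  defines "u \<equiv> 1 + v"
  defines "D \<equiv> min ((1 + t) / (u * t)) ((2 + v - v * t) / u)"
  shows "max 0 (min (Q - P) (v * P)) + max 0 (min (t * Q - P) (v * P)) / t \<le> (2 - D) * Q"
proof -
  have u: "1 \<le> u" using assms by (simp add: u_def)
  have D1: "2 * Q - (1 + t) / (u * t) * Q \<le> (2 - D) * Q"
    and D2: "2 * Q - (2 + v - v * t) / u * Q \<le> (2 - D) * Q"
  proof -
    have "D \<le> (1 + t) / (u * t)" "D \<le> (2 + v - v * t) / u" by (simp_all add: D_def)
    then have "D * Q \<le> (1 + t) / (u * t) * Q" "D * Q \<le> (2 + v - v * t) / u * Q"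
      using assms(4,5) by (intro mult_right_mono; simp)+
    then show "2 * Q - (1 + t) / (u * t) * Q \<le> (2 - D) * Q"
      "2 * Q - (2 + v - v * t) / u * Q \<le> (2 - D) * Q"
      by (simp_all add: left_diff_distrib)
  qed
  have Q0: "0 < Q" using assms by linarith
  have c2: "2 * Q - (2 + v - v * t) / u * Q = v * (1 + t) / u * Q"
    using u by (simp add: field_simps u_def)
  consider "t * Q \<le> P" | "P < t * Q" "u * P \<le> t * Q" | "P < t * Q" "t * Q < u * P" "u * P \<le> Q"
    | "P < t * Q" "t * Q < u * P" "Q < u * P" by linarith
  then show ?thesis
  proof cases
    case 1
    have "max 0 (min (Q - P) (v * P)) \<le> v / u * Q"
    proof -
      have "u * min (Q - P) (v * P) \<le> v * Q"
      proof (cases "Q \<le> u * P")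
        case True
        have "min (Q - P) (v * P) \<le> Q - P" by simp
        then have "u * min (Q - P) (v * P) \<le> u * (Q - P)" using u by (intro mult_left_mono) auto
        also have "\<dots> \<le> v * Q" using True by (simp add: u_def algebra_simps)
        finally show ?thesis .
      next
        case False
        have "u * min (Q - P) (v * P) \<le> u * (v * P)" using u by (intro mult_left_mono) auto
        also have "\<dots> = v * (u * P)" by simp
        also have "\<dots> \<le> v * Q" using False assms(1) by (intro mult_left_mono) auto
        finally show ?thesis .
      qed
      then have "min (Q - P) (v * P) \<le> v / u * Q" using u by (simp add: field_simps)
      moreover have "0 \<le> v / u * Q" using assms(1) u Q0 by simp
      ultimately show ?thesis by simp
    qed
    moreover have "v / u * Q \<le> v * (1 + t) / u * Q"
      using assms u Q0 by (intro mult_right_mono divide_right_mono) (auto simp: algebra_simps)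
    moreover have "max 0 (min (t * Q - P) (v * P)) / t = 0" using 1 by simp
    ultimately show ?thesis using D2 c2 by linarith
  next
    case 2
    have "max 0 (min (Q - P) (v * P)) \<le> v * P" "max 0 (min (t * Q - P) (v * P)) / t \<le> v * P / t"
      using assms by (auto intro!: divide_right_mono)
    moreover have "v * P + v * P / t \<le> v * (1 + t) / u * Q"
    proof -
      have "v * (1 + t) * (u * P) \<le> v * (1 + t) * (t * Q)"
        using 2 assms by (intro mult_left_mono) auto
      then show ?thesis using assms(2) u by (simp add: field_simps)
    qed
    ultimately show ?thesis using D2 c2 by linarith
  next
    case 3
    have b: "max 0 (min (Q - P) (v * P)) \<le> v * P"
      "max 0 (min (t * Q - P) (v * P)) / t \<le> Q - P / t"
      using assms 3 by (auto simp: field_simps max_def min_def)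
    show ?thesis
    proof (cases "1 \<le> v * t")
      case True
      have "v * P + (Q - P / t) \<le> 2 * Q - (1 + t) / (u * t) * Q"
      proof -
        have "v * P + (Q - P / t) = Q + (v * t - 1) * (u * P) / (u * t)"
          using assms(2) u by (simp add: field_simps)
        also have "\<dots> \<le> Q + (v * t - 1) * Q / (u * t)"
          using True 3 assms(2) u by (intro add_left_mono divide_right_mono mult_left_mono) auto
        also have "\<dots> = 2 * Q - (1 + t) / (u * t) * Q"
          using assms(2) u by (simp add: field_simps, simp add: u_def algebra_simps)
        finally show ?thesis .
      qed
      then show ?thesis using D1 b by linarith
    next
      case False
      have "v * P + (Q - P / t) \<le> v * (1 + t) / u * Q"
      proof -
        have "(1 - v * t) * (t * Q) \<le> (1 - v * t) * (u * P)" using False 3 by (intro mult_left_mono) auto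
        then show ?thesis using assms(2) u by (simp add: field_simps u_def)
      qed
      then show ?thesis using D2 c2 b by linarith
    qed
  next
    case 4
    have b: "max 0 (min (Q - P) (v * P)) \<le> Q - P"
      "max 0 (min (t * Q - P) (v * P)) / t \<le> Q - P / t"
      using assms 4 by (auto simp: field_simps max_def min_def)
    have "(Q - P) + (Q - P / t) = 2 * Q - (1 + t) * (u * P) / (u * t)"
      using assms(2) u by (simp add: field_simps)
    also have "\<dots> \<le> 2 * Q - (1 + t) * Q / (u * t)"
      using 4 assms(2) u by (intro diff_left_mono divide_right_mono mult_left_mono) auto
    finally have "(Q - P) + (Q - P / t) \<le> 2 * Q - (1 + t) / (u * t) * Q" by simp
    then show ?thesis using D1 b by linarith
  qed
qed

section \<open>Orbits of coded points\<close>

lemma full_lefts_bounds: "c \<in> full_lefts \<beta> m \<Longrightarrow> c \<in> {0..1 - 1 / \<beta> ^ m}"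
  by (auto simp: full_lefts_def)

lemma full_lefts_nonzero_ge:
  assumes "1 < \<beta>" "c \<in> full_lefts \<beta> m" "c \<noteq> 0"
  shows "1 / \<beta> ^ m \<le> c"
  using full_lefts_separated[OF assms(1) zero_in_full_lefts[OF assms(1)] assms(2)]
    full_lefts_bounds[OF assms(2)] assms(3) by auto

lemma full_lefts_separated_digits:
  assumes "1 < \<beta>" "1 \<le> m"
  shows "separated_digits (1 / \<beta> ^ m) (full_lefts \<beta> m)"
proof
  have "1 < \<beta> ^ m" using assms by (intro one_less_power) auto
  then show "0 < 1 / \<beta> ^ m" "1 / \<beta> ^ m < 1" by auto
  show "full_lefts \<beta> m \<subseteq> {0..1 - 1 / \<beta> ^ m}" using full_lefts_bounds by blast
  show "finite (full_lefts \<beta> m)" using card_full_lefts_le(1)[OF assms(1)] .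
  show "a + 1 / \<beta> ^ m \<le> b"
    if "a \<in> full_lefts \<beta> m" "b \<in> full_lefts \<beta> m" "a < b" for a b
    using full_lefts_separated[OF assms(1) that] .
qed

text \<open>Since \<open>T\<^sup>m\<close> inverts the affine map of each full word, \<open>T\<^sup>m\<close> acts on coded numbers as the shift.
  Infinitely many zero digits keep all tails below 1.\<close>

lemma beta_map_funpow_coded:
  assumes "1 < \<beta>" "1 \<le> m" and dig: "range \<omega> \<subseteq> full_lefts \<beta> m"
    and inf: "\<And>q. \<exists>k\<ge>q. \<omega> k = 0"
  defines "\<rho> \<equiv> 1 / \<beta> ^ m"
  shows "(beta_map \<beta> ^^ (m * q)) (coded \<rho> \<omega>) = coded \<rho> (\<lambda>i. \<omega> (i + q))"
    and "coded \<rho> (\<lambda>i. \<omega> (i + q)) \<in> {0..<1}"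
proof -
  interpret separated_digits \<rho> "full_lefts \<beta> m"
    unfolding \<rho>_def by (rule full_lefts_separated_digits[OF assms(1,2)])
  have b: "\<omega> i \<in> {0..1 - \<rho>}" for i using digit_bounds[OF dig] .
  have tail: "coded \<rho> (\<lambda>i. \<omega> (i + q)) \<in> {0..<1}" for q
  proof -
    obtain k where "k \<ge> q" "\<omega> k = 0" using inf by blast
    then have "coded \<rho> (\<lambda>i. \<omega> (i + q)) < 1"
      using b rho by (intro coded_less_1[of _ _ "k - q"]) auto
    moreover have "coded \<rho> (\<lambda>i. \<omega> (i + q)) \<in> {0..1}" using b rho by (intro coded_bounds) auto
    ultimately show ?thesis by auto
  qed
  then show "coded \<rho> (\<lambda>i. \<omega> (i + q)) \<in> {0..<1}" .
  show "(beta_map \<beta> ^^ (m * q)) (coded \<rho> \<omega>) = coded \<rho> (\<lambda>i. \<omega> (i + q))"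
  proof (induction q)
    case (Suc q)
    have "coded \<rho> (\<lambda>i. \<omega> (i + q)) = code_prefix \<rho> 1 (\<lambda>i. \<omega> (i + q)) +
        \<rho> ^ 1 * coded \<rho> (\<lambda>i. \<omega> (i + 1 + q))"
      using b rho by (intro coded_shift) auto
    also have "\<dots> = \<omega> q + coded \<rho> (\<lambda>i. \<omega> (i + Suc q)) / \<beta> ^ m"
      by (simp add: code_prefix_def \<rho>_def)
    finally have split: "coded \<rho> (\<lambda>i. \<omega> (i + q)) =
        \<omega> q + coded \<rho> (\<lambda>i. \<omega> (i + Suc q)) / \<beta> ^ m" .
    have "(beta_map \<beta> ^^ (m * Suc q)) (coded \<rho> \<omega>) =
        (beta_map \<beta> ^^ m) ((beta_map \<beta> ^^ (m * q)) (coded \<rho> \<omega>))"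
      by (simp add: funpow_add)
    also have "\<dots> = (beta_map \<beta> ^^ m) (\<omega> q + coded \<rho> (\<lambda>i. \<omega> (i + Suc q)) / \<beta> ^ m)"
      by (simp only: Suc split)
    also have "\<dots> = coded \<rho> (\<lambda>i. \<omega> (i + Suc q))"
      using dig tail[of "Suc q"] unfolding full_lefts_def by blast
    finally show ?case .
  qed simp
qed

context
  fixes \<beta> v :: real and m K :: nat and \<omega> :: "nat \<Rightarrow> real"
  assumes beta: "1 < \<beta>" and m: "1 \<le> m" and v: "0 \<le> v" and K: "v + 4 \<le> real K"
    and dig: "\<And>i. \<omega> i \<in> gap_digits \<beta> m (windows K v) i"
begin

lemma gap_digits_range: "range \<omega> \<subseteq> full_lefts \<beta> m"
  using dig zero_in_full_lefts[OF beta] unfolding gap_digits_def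
  by (metis DiffD1 image_subsetI singletonD)

lemma gap_digits_zero: "\<exists>k\<ge>q. \<omega> k = 0"
proof (intro exI conjI)
  have "1 < K" using v K by linarith
  then have "q < K ^ q" by (intro power_gt_expt) simp
  then show "q \<le> K ^ q" by simp
  show "\<omega> (K ^ q) = 0"
    using dig[of "K ^ q"] power_in_windows[OF v, of K q] by (simp add: gap_digits_def)
qed

lemmas orbit_coded = beta_map_funpow_coded[OF beta m gap_digits_range gap_digits_zero]

lemma gap_orbit_small:
  "(beta_map \<beta> ^^ (m * K ^ k)) (coded (1 / \<beta> ^ m) \<omega>) < \<beta> powr (- (real (m * K ^ k) * v))"
proof -
  define \<rho> where "\<rho> = 1 / \<beta> ^ m"
  define P where "P = K ^ k"
  define l where "l = nat \<lceil>v * P\<rceil>"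
  interpret separated_digits \<rho> "full_lefts \<beta> m"
    unfolding \<rho>_def by (rule full_lefts_separated_digits[OF beta m])
  have b: "\<omega> i \<in> {0..1 - \<rho>}" for i using digit_bounds[OF gap_digits_range] .
  have "\<omega> (i + P) = 0" if "i < l" for i
  proof -
    have "real i < v * P" using that unfolding l_def by linarith
    then have "i + P \<in> windows K v"
      unfolding windows_def P_def by (auto intro!: exI[of _ k] simp: algebra_simps)
    then show ?thesis using dig[of "i + P"] by (simp add: gap_digits_def)
  qed
  then have zero: "code_prefix \<rho> l (\<lambda>i. \<omega> (i + P)) = 0" by (simp add: code_prefix_def)
  have "(beta_map \<beta> ^^ (m * P)) (coded \<rho> \<omega>) = coded \<rho> (\<lambda>i. \<omega> (i + P))"
    unfolding \<rho>_def by (rule orbit_coded(1))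
  also have "\<dots> = code_prefix \<rho> l (\<lambda>i. \<omega> (i + P)) + \<rho> ^ l * coded \<rho> (\<lambda>i. \<omega> (i + l + P))"
    using b rho by (intro coded_shift) auto
  also have "\<dots> < \<rho> ^ l * 1"
    using orbit_coded(2)[of "l + P"] rho zero unfolding \<rho>_def
    by (simp add: add.assoc mult_less_cancel_left)
  also have "\<rho> ^ l * 1 = \<beta> powr (- (real m * real l))"
    using beta by (simp add: \<rho>_def power_divide powr_minus powr_realpow inverse_eq_divide
        flip: power_mult of_nat_mult)
  also have "\<dots> \<le> \<beta> powr (- (real (m * P) * v))"
  proof -
    have "v * P \<le> real l" unfolding l_def by linarith
    then have "real m * (v * P) \<le> real m * real l" by (intro mult_left_mono) auto
    then show ?thesis using beta by (intro powr_mono) (auto simp: mult_ac)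
  qed
  finally show ?thesis by (simp add: P_def \<rho>_def)
qed

text \<open>A small value is multiplied by \<open>\<beta>\<close> at every step, until the orbit reaches the next nonzero block,
  where it is at least \<open>1 / \<beta>\<^sup>m\<close>.  The distance to that block limits how small the value
  can have been.\<close>

lemma gap_orbit_not_small:
  assumes "(beta_map \<beta> ^^ n) (coded (1 / \<beta> ^ m) \<omega>) < \<beta> powr (- L)"
  shows "L \<le> v * real n + real m * (v + 4)"
proof -
  define \<rho> where "\<rho> = 1 / \<beta> ^ m"
  define x where "x = coded \<rho> \<omega>"
  interpret separated_digits \<rho> "full_lefts \<beta> m"
    unfolding \<rho>_def by (rule full_lefts_separated_digits[OF beta m])
  have b: "\<omega> i \<in> {0..1 - \<rho>}" for i using digit_bounds[OF gap_digits_range] .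
  define q where "q = n div m + 1"
  obtain q' where q': "q \<le> q'" "q' \<notin> windows K v" "real q' \<le> (1 + v) * real q + 2"
    using next_free_position[OF v K] .
  have "n \<le> m * q"
    using dividend_less_times_div[of m n] m by (simp add: q_def algebra_simps)
  also have "m * q \<le> m * q'" using q'(1) by simp
  finally have nq: "n \<le> m * q'" .
  define j where "j = m * q' - n"
  have qn: "m * real q \<le> real n + m"
  proof -
    have "m * q \<le> n + m" using div_times_less_eq_dividend[of n m] by (simp add: q_def mult_ac)
    then show ?thesis by (simp flip: of_nat_mult of_nat_add)
  qed
  have "real m * real q' \<le> real m * ((1 + v) * real q + 2)"
    using q'(3) by (intro mult_left_mono) auto
  also have "\<dots> = (1 + v) * (m * real q) + 2 * m" by (simp add: algebra_simps)
  also have "\<dots> \<le> (1 + v) * (real n + m) + 2 * m"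
    using qn v by (intro add_right_mono mult_left_mono) auto
  finally have jb: "real j + m \<le> v * real n + real m * (v + 4)"
    using nq by (simp add: j_def of_nat_diff algebra_simps)
  have "L \<le> real j + m"
  proof (rule ccontr)
    assume "\<not> L \<le> real j + m"
    then have L: "real j + m < L" by simp
    have "x \<in> {0..1}" unfolding x_def using coded_bounds[OF rho b] .
    then have y0: "0 \<le> (beta_map \<beta> ^^ n) x" by (intro beta_map_funpow_nonneg) auto
    have "\<beta> ^ j * (beta_map \<beta> ^^ n) x < \<beta> ^ j * \<beta> powr (- L)"
      using assms beta by (simp add: x_def \<rho>_def)
    also have "\<dots> = \<beta> powr (real j - L)"
      using beta by (simp add: powr_realpow[symmetric] powr_add[symmetric])
    also have "\<dots> \<le> \<beta> powr (- real m)" using L beta by (intro powr_mono) auto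
    also have "\<dots> = \<rho>" using beta by (simp add: \<rho>_def powr_minus powr_realpow inverse_eq_divide)
    finally have small: "\<beta> ^ j * (beta_map \<beta> ^^ n) x < \<rho>" .
    have "(beta_map \<beta> ^^ (m * q')) x = (beta_map \<beta> ^^ j) ((beta_map \<beta> ^^ n) x)"
      using nq by (simp add: j_def flip: comp_apply[of "beta_map \<beta> ^^ _"] funpow_add)
    also have "\<dots> = \<beta> ^ j * (beta_map \<beta> ^^ n) x"
      using small rho by (intro beta_map_funpow_small beta y0) simp
    finally have "coded \<rho> (\<lambda>i. \<omega> (i + q')) < \<rho>"
      using small orbit_coded(1)[of q'] by (simp add: x_def \<rho>_def)
    moreover have "coded \<rho> (\<lambda>i. \<omega> (i + q')) =
        code_prefix \<rho> 1 (\<lambda>i. \<omega> (i + q')) + \<rho> ^ 1 * coded \<rho> (\<lambda>i. \<omega> (i + 1 + q'))"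
      using b rho by (intro coded_shift) auto
    moreover have "0 \<le> \<rho> ^ 1 * coded \<rho> (\<lambda>i. \<omega> (i + 1 + q'))"
      using coded_bounds[of \<rho> "\<lambda>i. \<omega> (i + 1 + q')"] b rho by auto
    moreover have "\<rho> \<le> \<omega> q'"
      using dig[of q'] q'(2) full_lefts_nonzero_ge[OF beta]
      by (simp add: gap_digits_def \<rho>_def)
    ultimately show False by (simp add: code_prefix_def)
  qed
  then show ?thesis using jb by linarith
qed

end

text \<open>The windows make both orbits small at the times \<open>m * K ^ k\<close>.  That the exponent is not
  larger than \<open>v\<close> is decided by the first coordinate alone.\<close>

lemma coded_point_exponent:
  assumes b1: "1 < \<beta>1" and b2: "1 < \<beta>2" and m: "1 \<le> m" and v: "0 \<le> v" and K: "v + 4 \<le> real K"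
    and w1: "\<And>i. \<omega>1 i \<in> gap_digits \<beta>1 m (windows K v) i"
    and w2: "\<And>i. \<omega>2 i \<in> gap_digits \<beta>2 m (windows K v) i"
  defines "p \<equiv> (coded (1 / \<beta>1 ^ m) \<omega>1, coded (1 / \<beta>2 ^ m) \<omega>2)"
  shows "p \<in> A_set \<beta>1 \<beta>2 (ereal v) \<inter> W_set \<beta>1 \<beta>2 v"
proof -
  let ?N = "\<lambda>v. {n::nat. 1 \<le> n \<and> (beta_map \<beta>1 ^^ n) (fst p) < \<beta>1 powr (- (real n * v))
      \<and> (beta_map \<beta>2 ^^ n) (snd p) < \<beta>2 powr (- (real n * v))}"
  have K1: "1 < K" using v K by linarith
  have "range (\<lambda>k. m * K ^ k) \<subseteq> ?N v"
    using gap_orbit_small[OF b1 m v K w1] gap_orbit_small[OF b2 m v K w2] m K1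
    by (auto simp: p_def)
  moreover have "inj (\<lambda>k. m * K ^ k)" using m K1 by (auto intro!: injI)
  then have "infinite (range (\<lambda>k. m * K ^ k))" by (rule range_inj_infinite)
  ultimately have io: "approx_io \<beta>1 \<beta>2 v p" unfolding approx_io_def using infinite_super by blast
  have p01: "p \<in> {0..1} \<times> {0..1}"
    using beta_map_funpow_coded(2)[OF b1 m gap_digits_range[OF b1 m v K w1] gap_digits_zero[OF b1 m v K w1], of 0]
      beta_map_funpow_coded(2)[OF b2 m gap_digits_range[OF b2 m v K w2] gap_digits_zero[OF b2 m v K w2], of 0]
    by (simp add: p_def)
  have le: "w \<le> v" if io_w: "approx_io \<beta>1 \<beta>2 w p" for w
  proof (rule ccontr)
    assume "\<not> w \<le> v"
    then have d: "0 < w - v" by simp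
    have "?N w \<subseteq> {n. real n \<le> real m * (v + 4) / (w - v)}"
    proof
      fix n assume "n \<in> ?N w"
      then have "real n * w \<le> v * real n + real m * (v + 4)"
        by (intro gap_orbit_not_small[OF b1 m v K w1]) (auto simp: p_def)
      then have "real n * (w - v) \<le> real m * (v + 4)" by (simp add: algebra_simps)
      then show "n \<in> {n. real n \<le> real m * (v + 4) / (w - v)}"
        using d by (simp add: pos_le_divide_eq)
    qed
    moreover have "finite {n. real n \<le> real m * (v + 4) / (w - v)}"
      by (rule finite_subset[of _ "{..nat \<lfloor>real m * (v + 4) / (w - v)\<rfloor>}"])
        (auto simp: le_nat_floor)
    ultimately show False using io_w finite_subset unfolding approx_io_def by blast
  qed
  have "approx_exponent \<beta>1 \<beta>2 p = ereal v"
    unfolding approx_exponent_def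
  proof (rule antisym)
    show "Sup {ereal v |v. 0 \<le> v \<and> approx_io \<beta>1 \<beta>2 v p} \<le> ereal v"
      using le by (intro Sup_least) auto
    show "ereal v \<le> Sup {ereal v |v. 0 \<le> v \<and> approx_io \<beta>1 \<beta>2 v p}"
      using io v by (intro Sup_upper) auto
  qed
  then show ?thesis using io p01 by (simp add: A_set_def W_set_def)
qed

section \<open>The lower bound\<close>

text \<open>With \<open>t = log \<beta>2 \<beta>1\<close> and \<open>u = 1 + v\<close>, the first number exceeds the second by
  \<open>(1 - t) * ((1 + t) / (u * t) - 1)\<close>, which is nonnegative if \<open>u * t < 1\<close>, that is, if
  \<open>\<beta>1 powr u < \<beta>2\<close>.\<close>

lemma dim_value_eq_min:
  assumes "1 < \<beta>1" "\<beta>1 \<le> \<beta>2" "0 \<le> v"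
  shows "dim_value \<beta>1 \<beta>2 v =
    min ((1 + log \<beta>2 \<beta>1) / ((1 + v) * log \<beta>2 \<beta>1)) ((2 + v - v * log \<beta>2 \<beta>1) / (1 + v))"
proof (cases "\<beta>1 powr (1 + v) < \<beta>2")
  case True
  define t where "t = log \<beta>2 \<beta>1"
  define u where "u = 1 + v"
  have ln: "0 < ln \<beta>1" "ln \<beta>1 \<le> ln \<beta>2" using assms by auto
  then have t: "0 < t" "t \<le> 1" by (auto simp: t_def log_def)
  have u: "1 \<le> u" using assms by (simp add: u_def)
  have "ln (\<beta>1 powr u) < ln \<beta>2" using True assms by (subst ln_less_cancel_iff) (auto simp: u_def)
  then have "u * ln \<beta>1 < ln \<beta>2" using assms by (simp add: ln_powr)
  then have "u * t \<le> 1" using ln by (simp add: t_def log_def)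
  then have "(1 - t) * (u * t) \<le> (1 - t) * 1" using t by (intro mult_left_mono) auto
  moreover have "t * t \<le> t * 1" using t by (intro mult_left_mono) auto
  ultimately have "(2 + v - v * t) * t \<le> 1 + t" by (simp add: u_def algebra_simps)
  then have "((2 + v - v * t) * t) / (u * t) \<le> (1 + t) / (u * t)"
    using t u by (intro divide_right_mono) auto
  then have "(2 + v - v * t) / u \<le> (1 + t) / (u * t)" using t by simp
  then show ?thesis using True by (simp add: dim_value_def t_def u_def min_def)
qed (simp add: dim_value_def)

lemma many_full_words:
  assumes "1 < \<beta>" "0 < \<kappa>" "\<kappa> < 1"
  shows "\<forall>\<^sub>F m in sequentially. exp (real m * \<kappa> * ln \<beta>) \<le> real (card (full_lefts \<beta> m - {0}))"
proof -
  define a where "a = ln \<beta>"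
  define c where "c = \<kappa> * a"
  define d where "d = a - c"
  have "0 < a" using assms by (simp add: a_def)
  then have "0 < c" "0 < d" using assms by (simp_all add: c_def d_def)
  then have "\<forall>\<^sub>F m in sequentially. exp (real m * c) \<le> exp (real m * (c + d)) / (real m + 1) - 1"
    by real_asymp
  then have "\<forall>\<^sub>F m in sequentially. exp (real m * \<kappa> * a) \<le> exp (real m * a) / (real m + 1) - 1"
    by (simp add: c_def d_def mult.assoc)
  then show ?thesis
  proof (rule eventually_mono)
    fix m assume m: "exp (real m * \<kappa> * a) \<le> exp (real m * a) / (real m + 1) - 1"
    have "exp (real m * a) = \<beta> ^ m" using assms by (simp add: a_def exp_of_nat_mult)
    then have "exp (real m * a) / (real m + 1) \<le> card (full_lefts \<beta> m)"
      using card_full_lefts_ge[OF assms(1), of m] by (simp add: field_simps)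
    moreover have "real (card (full_lefts \<beta> m - {0})) = real (card (full_lefts \<beta> m)) - 1"
    proof -
      have z: "0 \<in> full_lefts \<beta> m" "finite (full_lefts \<beta> m)"
        using zero_in_full_lefts card_full_lefts_le(1) assms by auto
      then show ?thesis using card_Suc_Diff1[OF z(2,1)] by linarith
    qed
    ultimately show "exp (real m * \<kappa> * ln \<beta>) \<le> real (card (full_lefts \<beta> m - {0}))"
      using m by (simp add: a_def)
  qed
qed

text \<open>The mass of a cylinder depends on the number of free blocks only; the loss of 1 comes from rounding
  \<open>Q\<close> down.\<close>

lemma gap_digits_cylinder_mass:
  fixes Q c :: real and Z :: "nat set"
  assumes "0 \<le> Q" "0 \<le> c" and N: "exp c \<le> real (card (full_lefts \<beta> m - {0}))"
  shows "(\<Prod>i<nat \<lfloor>Q\<rfloor>. 1 / real (card (gap_digits \<beta> m Z i)))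
    \<le> exp (- (c * (Q - 1 - real (card {q \<in> Z. real q < Q}))))"
proof -
  define N where "N = real (card (full_lefts \<beta> m - {0}))"
  define q where "q = nat \<lfloor>Q\<rfloor>"
  define z where "z = card {q \<in> Z. real q < Q}"
  have q: "real q \<le> Q" "Q < real q + 1" using assms(1) by (auto simp: q_def)
  have N1: "exp c \<le> N" "0 < N" using N less_le_trans[OF exp_gt_zero N] by (auto simp: N_def)
  have fin: "finite {q \<in> Z. real q < Q}"
    using card_nat_interval_le(1)[of 0 Q] by (rule finite_subset[rotated]) auto
  have "card ({..<q} \<inter> Z) \<le> z"
    unfolding z_def using q fin by (intro card_mono) auto
  moreover have "card ({..<q} - Z) + card ({..<q} \<inter> Z) = q"
    using card_Diff_subset_Int[of "{..<q}" Z] card_mono[of "{..<q}" "{..<q} \<inter> Z"] by simp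
  ultimately have g: "Q - 1 - real z \<le> real (card ({..<q} - Z))" using q by linarith
  have "(\<Prod>i<q. 1 / real (card (gap_digits \<beta> m Z i))) = (\<Prod>i<q. if i \<in> Z then 1 else 1 / N)"
    by (intro prod.cong) (auto simp: gap_digits_def N_def)
  also have "\<dots> = (\<Prod>i\<in>{..<q} - Z. 1 / N)"
    by (simp add: prod.If_cases Diff_eq)
  also have "\<dots> = (1 / N) ^ card ({..<q} - Z)" by simp
  also have "\<dots> \<le> (1 / exp c) ^ card ({..<q} - Z)"
    using N1 by (intro power_mono divide_left_mono) auto
  also have "\<dots> = exp (- (c * real (card ({..<q} - Z))))"
    by (simp add: exp_minus inverse_eq_divide power_divide exp_of_nat_mult mult.commute[of c])
  also have "\<dots> \<le> exp (- (c * (Q - 1 - real z)))"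
    using g assms(2) by (simp add: mult_left_mono)
  finally show ?thesis by (simp add: q_def z_def)
qed

text \<open>The pair of orbits is coded by independent digits.  A set of diameter \<open>r = exp (- m * L)\<close> fixes
  about \<open>Q1 = L / ln \<beta>1\<close> blocks of the first coordinate and \<open>Q2 = L / ln \<beta>2\<close> of the second, each free
  block contributing a factor of about \<open>1 / \<beta>\<^sup>m\<close>.  Without windows this
  would give \<open>r\<^sup>2\<close>; by \<open>window_mass_deficit\<close> the windows lower the exponent to \<open>D\<close> at worst.\<close>

lemma hausdorff_measure_A_W_positive:
  fixes \<beta>1 \<beta>2 v s :: real
  assumes b1: "1 < \<beta>1" and b12: "\<beta>1 \<le> \<beta>2" and v: "0 \<le> v"
    and s: "0 < s" "s < dim_value \<beta>1 \<beta>2 v"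
  shows "hausdorff_measure s (A_set \<beta>1 \<beta>2 (ereal v) \<inter> W_set \<beta>1 \<beta>2 v) \<noteq> 0"
proof -
  define a where "a = ln \<beta>1"
  define b where "b = ln \<beta>2"
  define t where "t = log \<beta>2 \<beta>1"
  define D where "D = dim_value \<beta>1 \<beta>2 v"
  \<comment> \<open>\<open>\<eta>\<close> bounds the density of the earlier windows and \<open>\<kappa>\<close> the loss from using full words only; they
    are chosen such that \<open>s = \<kappa> * (D - 2 * \<eta>)\<close>\<close>
  define \<eta> where "\<eta> = (D - s) / 4"
  define \<kappa> where "\<kappa> = 2 * s / (D + s)"
  have b2: "1 < \<beta>2" using b1 b12 by simp
  have a0: "0 < a" and ab: "a \<le> b" using b1 b12 by (auto simp: a_def b_def)
  have t: "0 < t" "t \<le> 1" and bt: "b * t = a" using a0 ab by (auto simp: t_def log_def a_def b_def)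
  have D_eq: "D = min ((1 + t) / ((1 + v) * t)) ((2 + v - v * t) / (1 + v))"
    using dim_value_eq_min[OF b1 b12 v] by (simp add: D_def t_def)
  have sD: "s < D" using s(2) by (simp add: D_def)
  have eta: "0 < \<eta>" using sD by (simp add: \<eta>_def)
  have kappa: "0 < \<kappa>" "\<kappa> < 1" using s(1) sD by (auto simp: \<kappa>_def)
  have exponent: "s = \<kappa> * (D - 2 * \<eta>)"
    using s(1) sD by (simp add: \<kappa>_def \<eta>_def field_simps)
  obtain K :: nat where K: "v + 4 + (v + 2) / (t * \<eta>) \<le> real K" using real_arch_simple by blast
  have "0 \<le> (v + 2) / (t * \<eta>)" using v t eta by simp
  then have K4: "v + 4 \<le> real K" and K2: "2 \<le> K" using K v by linarith+
  have "(v + 2) / (t * \<eta>) \<le> real K - 1" using K v by linarith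
  then have K_eta: "(v + 2) / (t * (real K - 1)) \<le> \<eta>"
    using t eta K2 by (simp add: field_simps)
  have "\<forall>\<^sub>F m in sequentially. 1 \<le> m \<and>
      exp (real m * \<kappa> * ln \<beta>1) \<le> real (card (full_lefts \<beta>1 m - {0})) \<and>
      exp (real m * \<kappa> * ln \<beta>2) \<le> real (card (full_lefts \<beta>2 m - {0}))"
    by (intro eventually_conj many_full_words b1 b2 kappa eventually_ge_at_top)
  then obtain m where m: "1 \<le> m"
      and N1: "exp (real m * \<kappa> * ln \<beta>1) \<le> real (card (full_lefts \<beta>1 m - {0}))"
      and N2: "exp (real m * \<kappa> * ln \<beta>2) \<le> real (card (full_lefts \<beta>2 m - {0}))"
    unfolding eventually_sequentially by blast
  define Z where "Z = windows K v"
  define D1 where "D1 = gap_digits \<beta>1 m Z"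
  define D2 where "D2 = gap_digits \<beta>2 m Z"
  define \<rho>1 where "\<rho>1 = 1 / \<beta>1 ^ m"
  define \<rho>2 where "\<rho>2 = 1 / \<beta>2 ^ m"
  define M1 where "M1 = PiM UNIV (\<lambda>i. uniform_count_measure (D1 i))"
  define M2 where "M2 = PiM UNIV (\<lambda>i. uniform_count_measure (D2 i))"
  interpret F1: separated_digits \<rho>1 "full_lefts \<beta>1 m"
    unfolding \<rho>1_def by (rule full_lefts_separated_digits[OF b1 m])
  interpret F2: separated_digits \<rho>2 "full_lefts \<beta>2 m"
    unfolding \<rho>2_def by (rule full_lefts_separated_digits[OF b2 m])
  have ne: "gap_digits \<beta> m Z i \<noteq> {}"
    if "exp (real m * \<kappa> * ln \<beta>) \<le> real (card (full_lefts \<beta> m - {0}))" for \<beta> i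
  proof -
    have "0 < real (card (full_lefts \<beta> m - {0}))" using less_le_trans[OF exp_gt_zero that] .
    then have "full_lefts \<beta> m - {0} \<noteq> {}" by (metis card.empty less_irrefl of_nat_0)
    then show ?thesis by (simp add: gap_digits_def)
  qed
  have D1: "D1 i \<subseteq> full_lefts \<beta>1 m" "D1 i \<noteq> {}" and D2: "D2 i \<subseteq> full_lefts \<beta>2 m" "D2 i \<noteq> {}" for i
    using ne[OF N1] ne[OF N2] zero_in_full_lefts[OF b1, of m] zero_in_full_lefts[OF b2, of m]
    unfolding D1_def D2_def by (auto simp: gap_digits_def)
  have P1: "prob_space M1" and P2: "prob_space M2"
    unfolding M1_def M2_def
    using D1(2) D2(2) finite_subset[OF D1(1) F1.F_fin] finite_subset[OF D2(1) F2.F_fin]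
    by (auto intro!: prob_space_PiM prob_space_uniform_count_measure)
  interpret M1: prob_space M1 by (rule P1)
  interpret M2: prob_space M2 by (rule P2)
  have sp1: "\<omega> \<in> space M1 \<Longrightarrow> \<omega> i \<in> gap_digits \<beta>1 m (windows K v) i"
    and sp2: "\<omega> \<in> space M2 \<Longrightarrow> \<omega> i \<in> gap_digits \<beta>2 m (windows K v) i" for \<omega> i
    unfolding M1_def M2_def D1_def D2_def Z_def
    by (auto simp: space_PiM space_uniform_count_measure PiE_UNIV_domain Pi_iff)
  define X where "X = (\<lambda>(\<omega>1, \<omega>2). (coded \<rho>1 \<omega>1, coded \<rho>2 \<omega>2))"
  define C where "C = 16 * exp (3 * (real m * \<kappa> * (a + b)))"
  show ?thesis
  proof (rule hausdorff_measure_neq_0_mass_distribution[where M = "M1 \<Otimes>\<^sub>M M2" and X = X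
        and C = C and \<delta> = "exp (- (real m * a))"])
    show "prob_space (M1 \<Otimes>\<^sub>M M2)" by (rule prob_space_pair[OF P1 P2])
    show "X \<omega> \<in> A_set \<beta>1 \<beta>2 (ereal v) \<inter> W_set \<beta>1 \<beta>2 v" if w0: "\<omega> \<in> space (M1 \<Otimes>\<^sub>M M2)" for \<omega>
    proof -
      obtain \<omega>1 \<omega>2 where w: "\<omega> = (\<omega>1, \<omega>2)" "\<omega>1 \<in> space M1" "\<omega>2 \<in> space M2"
        using w0 by (auto simp: space_pair_measure)
      show ?thesis
        unfolding w X_def prod.case \<rho>1_def \<rho>2_def
        by (rule coded_point_exponent[OF b1 b2 m v K4]) (intro sp1 sp2 w(2,3))+
    qed
    fix S :: "(real \<times> real) set" and r :: real
    assume r: "0 < r" "r \<le> exp (- (real m * a))"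
      and S: "\<And>x y. x \<in> S \<Longrightarrow> y \<in> S \<Longrightarrow> dist x y \<le> r"
    define L where "L = ln (1 / r) / real m"
    define Q1 where "Q1 = L / a"
    define Q2 where "Q2 = L / b"
    have r_eq: "r = exp (- (real m * L))" using r(1) m by (simp add: L_def ln_div)
    then have "a \<le> L" using r(2) m by simp
    then have Q1: "1 \<le> Q1" using a0 by (simp add: Q1_def)
    have L0: "0 < L" using \<open>a \<le> L\<close> a0 by simp
    have Q2: "Q2 = t * Q1" "0 < Q2" using a0 ab bt L0 by (auto simp: Q1_def Q2_def field_simps)
    have aQ: "a * Q1 = L" "b * Q2 = L" using a0 ab by (auto simp: Q1_def Q2_def)
    have radius: "r \<le> (1 / \<beta> ^ m) ^ nat \<lfloor>L / ln \<beta>\<rfloor>" if "1 < \<beta>" for \<beta>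
    proof -
      have pos: "0 < ln \<beta>" using that by simp
      have "real (nat \<lfloor>L / ln \<beta>\<rfloor>) \<le> L / ln \<beta>" using L0 pos by simp
      then have "real (nat \<lfloor>L / ln \<beta>\<rfloor>) * ln \<beta> \<le> L" using pos by (simp add: pos_le_divide_eq)
      then have "real m * (real (nat \<lfloor>L / ln \<beta>\<rfloor>) * ln \<beta>) \<le> real m * L"
        by (intro mult_left_mono) auto
      then have "r \<le> exp (- (real m * (real (nat \<lfloor>L / ln \<beta>\<rfloor>) * ln \<beta>)))"
        by (simp add: r_eq)
      also have "\<dots> = exp (- ln \<beta>) ^ (m * nat \<lfloor>L / ln \<beta>\<rfloor>)"
        by (simp flip: exp_of_nat_mult)
      also have "\<dots> = (1 / \<beta> ^ m) ^ nat \<lfloor>L / ln \<beta>\<rfloor>"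
        using that by (simp add: exp_minus power_mult inverse_eq_divide power_divide)
      finally show ?thesis .
    qed
    define q1 where "q1 = nat \<lfloor>Q1\<rfloor>"
    define q2 where "q2 = nat \<lfloor>Q2\<rfloor>"
    have close1: "\<bar>x - y\<bar> \<le> \<rho>1 ^ q1" if xy: "x \<in> fst ` S" "y \<in> fst ` S" for x y
    proof -
      obtain p p' where p: "p \<in> S" "p' \<in> S" "x = fst p" "y = fst p'" using xy by auto
      have "dist x y \<le> dist p p'" unfolding p(3,4) by (rule dist_fst_le)
      also have "\<dots> \<le> r" using S p by blast
      also have "\<dots> \<le> \<rho>1 ^ q1"
        using radius[OF b1] by (simp add: \<rho>1_def q1_def Q1_def a_def)
      finally show ?thesis by (simp add: dist_real_def)
    qed
    have "\<exists>E\<in>sets M1. {\<omega> \<in> space M1. coded \<rho>1 \<omega> \<in> fst ` S} \<subseteq> E \<and>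
        emeasure M1 E \<le> ennreal (4 * (\<Prod>i<q1. 1 / real (card (D1 i))))"
      unfolding M1_def by (rule F1.coded_small_set_measure[OF D1 close1])
    then obtain E1 where E1: "E1 \<in> sets M1" "{\<omega> \<in> space M1. coded \<rho>1 \<omega> \<in> fst ` S} \<subseteq> E1"
        "emeasure M1 E1 \<le> ennreal (4 * (\<Prod>i<q1. 1 / real (card (D1 i))))"
      by (elim bexE conjE)
    have close2: "\<bar>x - y\<bar> \<le> \<rho>2 ^ q2" if xy: "x \<in> snd ` S" "y \<in> snd ` S" for x y
    proof -
      obtain p p' where p: "p \<in> S" "p' \<in> S" "x = snd p" "y = snd p'" using xy by auto
      have "dist x y \<le> dist p p'" unfolding p(3,4) by (rule dist_snd_le)
      also have "\<dots> \<le> r" using S p by blast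
      also have "\<dots> \<le> \<rho>2 ^ q2"
        using radius[OF b2] by (simp add: \<rho>2_def q2_def Q2_def b_def)
      finally show ?thesis by (simp add: dist_real_def)
    qed
    have "\<exists>E\<in>sets M2. {\<omega> \<in> space M2. coded \<rho>2 \<omega> \<in> snd ` S} \<subseteq> E \<and>
        emeasure M2 E \<le> ennreal (4 * (\<Prod>i<q2. 1 / real (card (D2 i))))"
      unfolding M2_def by (rule F2.coded_small_set_measure[OF D2 close2])
    then obtain E2 where E2: "E2 \<in> sets M2" "{\<omega> \<in> space M2. coded \<rho>2 \<omega> \<in> snd ` S} \<subseteq> E2"
        "emeasure M2 E2 \<le> ennreal (4 * (\<Prod>i<q2. 1 / real (card (D2 i))))"
      by (elim bexE conjE)
    show "\<exists>E\<in>sets (M1 \<Otimes>\<^sub>M M2). {\<omega> \<in> space (M1 \<Otimes>\<^sub>M M2). X \<omega> \<in> S} \<subseteq> E \<and>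
        emeasure (M1 \<Otimes>\<^sub>M M2) E \<le> ennreal (C * r powr s)"
    proof (intro bexI[of _ "E1 \<times> E2"] conjI)
      show "E1 \<times> E2 \<in> sets (M1 \<Otimes>\<^sub>M M2)" using E1(1) E2(1) by simp
      show "{\<omega> \<in> space (M1 \<Otimes>\<^sub>M M2). X \<omega> \<in> S} \<subseteq> E1 \<times> E2"
      proof (rule subsetI)
        fix \<omega> assume w: "\<omega> \<in> {\<omega> \<in> space (M1 \<Otimes>\<^sub>M M2). X \<omega> \<in> S}"
        obtain \<omega>1 \<omega>2 where eq: "\<omega> = (\<omega>1, \<omega>2)" by fastforce
        have "\<omega>1 \<in> space M1" "\<omega>2 \<in> space M2" "(coded \<rho>1 \<omega>1, coded \<rho>2 \<omega>2) \<in> S"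
          using w by (auto simp: eq X_def space_pair_measure)
        then have "\<omega>1 \<in> E1" "\<omega>2 \<in> E2" using E1(2) E2(2) by (force, force)
        then show "\<omega> \<in> E1 \<times> E2" by (simp add: eq)
      qed
      define z1 where "z1 = real (card {q \<in> Z. real q < Q1})"
      define z2 where "z2 = real (card {q \<in> Z. real q < Q2})"
      define c1 where "c1 = real m * \<kappa> * a"
      define c2 where "c2 = real m * \<kappa> * b"
      have mk: "0 \<le> real m * \<kappa>" using kappa by simp
      have c0: "0 \<le> c1" "0 \<le> c2" using mk a0 ab by (auto simp: c1_def c2_def)
      have pr1: "(\<Prod>i<q1. 1 / real (card (D1 i))) \<le> exp (- (c1 * (Q1 - 1 - z1)))"
        unfolding q1_def D1_def z1_def
        by (rule gap_digits_cylinder_mass) (use Q1 c0 N1 in \<open>auto simp: c1_def a_def\<close>)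
      have pr2: "(\<Prod>i<q2. 1 / real (card (D2 i))) \<le> exp (- (c2 * (Q2 - 1 - z2)))"
        unfolding q2_def D2_def z2_def
        by (rule gap_digits_cylinder_mass) (use Q2 c0 N2 in \<open>auto simp: c2_def b_def\<close>)
      \<comment> \<open>the scale \<open>K ^ k\<close> of the window that is active at this radius\<close>
      have "\<exists>k. real (K ^ k) \<le> Q1 \<and> Q1 < real (K ^ Suc k)"
      proof -
        obtain j where j: "Q1 < real K ^ j" using real_arch_pow[of "real K" Q1] K2 by auto
        have ex: "\<exists>j. Q1 < real (K ^ j)" using j by auto
        define j0 where "j0 = (LEAST j. Q1 < real (K ^ j))"
        have j0: "Q1 < real (K ^ j0)" unfolding j0_def using LeastI_ex[OF ex] .
        then have "j0 \<noteq> 0" using Q1 by (intro notI) simp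
        then obtain k where k: "j0 = Suc k" using not0_implies_Suc by blast
        then have "\<not> Q1 < real (K ^ k)" unfolding j0_def by (metis lessI not_less_Least)
        then show ?thesis using j0 unfolding k by (intro exI[of _ k]) auto
      qed
      then obtain k where k: "real (K ^ k) \<le> Q1" "Q1 < real (K ^ Suc k)" by blast
      define P where "P = real (K ^ k)"
      have P0: "0 < P" using K2 by (simp add: P_def)
      have tP: "t * P \<le> P" using t P0 by simp
      have tQ: "t * Q1 \<le> Q1" using t Q1 by simp
      have z1: "z1 \<le> \<eta> * Q1 + max 0 (min (Q1 - P) (v * P)) + 2"
      proof -
        have "z1 \<le> (v + 2) / (t * (real K - 1)) * Q1 + max 0 (min (Q1 - P) (v * P)) + 2"
          unfolding z1_def Z_def P_def
          by (rule card_windows_below[OF v K2 t(1) _ k(2)]) (use k tP in \<open>simp add: P_def\<close>)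
        moreover have "(v + 2) / (t * (real K - 1)) * Q1 \<le> \<eta> * Q1"
          using K_eta Q1 by (intro mult_right_mono) auto
        ultimately show ?thesis by linarith
      qed
      have z2: "z2 \<le> \<eta> * Q2 + max 0 (min (Q2 - P) (v * P)) + 2"
      proof -
        have "z2 \<le> (v + 2) / (t * (real K - 1)) * Q2 + max 0 (min (Q2 - P) (v * P)) + 2"
          unfolding z2_def Z_def P_def
          by (rule card_windows_below[OF v K2 t(1)]) (use k tQ t(1) in \<open>simp_all add: Q2\<close>)
        moreover have "(v + 2) / (t * (real K - 1)) * Q2 \<le> \<eta> * Q2"
          using K_eta Q2 by (intro mult_right_mono) auto
        ultimately show ?thesis by linarith
      qed
      have deficit: "a * max 0 (min (Q1 - P) (v * P)) + b * max 0 (min (Q2 - P) (v * P)) \<le> (2 - D) * L"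
      proof -
        have "max 0 (min (Q1 - P) (v * P)) + max 0 (min (t * Q1 - P) (v * P)) / t \<le> (2 - D) * Q1"
          using window_mass_deficit[OF v t P0, of Q1] k(1) unfolding D_eq P_def by simp
        then have "a * (max 0 (min (Q1 - P) (v * P)) + max 0 (min (t * Q1 - P) (v * P)) / t)
            \<le> a * ((2 - D) * Q1)"
          using a0 by (intro mult_left_mono) auto
        moreover have "a / t = b" using bt t by (simp add: field_simps)
        then have "a * (max 0 (min (t * Q1 - P) (v * P)) / t) = b * max 0 (min (Q2 - P) (v * P))"
          unfolding Q2(1) by (metis times_divide_eq_left times_divide_eq_right)
        moreover have "a * ((2 - D) * Q1) = (2 - D) * L" using aQ by simp
        ultimately show ?thesis by (simp only: distrib_left)
      qed
      have "a * z1 + b * z2 \<le> a * (\<eta> * Q1 + max 0 (min (Q1 - P) (v * P)) + 2)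
          + b * (\<eta> * Q2 + max 0 (min (Q2 - P) (v * P)) + 2)"
        using z1 z2 a0 ab by (intro add_mono mult_left_mono) auto
      also have "\<dots> = \<eta> * (a * Q1) + \<eta> * (b * Q2) + 2 * (a + b) +
          (a * max 0 (min (Q1 - P) (v * P)) + b * max 0 (min (Q2 - P) (v * P)))"
        by (simp add: algebra_simps)
      also have "\<dots> \<le> \<eta> * L + \<eta> * L + 2 * (a + b) + (2 - D) * L"
        using deficit by (simp add: aQ)
      finally have "a * (Q1 - 1 - z1) + b * (Q2 - 1 - z2) \<ge> (D - 2 * \<eta>) * L - 3 * (a + b)"
        using aQ by (simp add: algebra_simps)
      then have "real m * \<kappa> * ((D - 2 * \<eta>) * L - 3 * (a + b)) \<le>
          real m * \<kappa> * (a * (Q1 - 1 - z1) + b * (Q2 - 1 - z2))"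
        using mk by (intro mult_left_mono) auto
      also have "\<dots> = c1 * (Q1 - 1 - z1) + c2 * (Q2 - 1 - z2)"
        by (simp only: c1_def c2_def distrib_left mult.assoc)
      finally have total: "- (c1 * (Q1 - 1 - z1)) + - (c2 * (Q2 - 1 - z2)) \<le>
          3 * (real m * \<kappa> * (a + b)) - s * (real m * L)"
        unfolding exponent by (simp add: algebra_simps)
      have "emeasure (M1 \<Otimes>\<^sub>M M2) (E1 \<times> E2) = emeasure M1 E1 * emeasure M2 E2"
        using E1(1) E2(1) by (rule M2.emeasure_pair_measure_Times)
      also have "\<dots> \<le> ennreal (4 * (\<Prod>i<q1. 1 / real (card (D1 i)))) *
          ennreal (4 * (\<Prod>i<q2. 1 / real (card (D2 i))))"
        using E1(3) E2(3) by (rule mult_mono) auto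
      also have "\<dots> \<le> ennreal (4 * exp (- (c1 * (Q1 - 1 - z1)))) *
          ennreal (4 * exp (- (c2 * (Q2 - 1 - z2))))"
        using pr1 pr2 by (intro mult_mono ennreal_leI mult_left_mono) auto
      also have "\<dots> = ennreal (16 * exp (- (c1 * (Q1 - 1 - z1)) + - (c2 * (Q2 - 1 - z2))))"
        unfolding exp_add by (simp add: ennreal_mult[symmetric] mult_ac)
      also have "\<dots> \<le> ennreal (16 * exp (3 * (real m * \<kappa> * (a + b)) - s * (real m * L)))"
        using total by (intro ennreal_leI) simp
      also have "16 * exp (3 * (real m * \<kappa> * (a + b)) - s * (real m * L)) = C * r powr s"
      proof -
        have "r powr s = exp (- (s * (real m * L)))" by (simp add: r_eq exp_powr_real mult_ac)
        then show ?thesis by (simp add: C_def exp_diff exp_minus divide_inverse)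
      qed
      finally show "emeasure (M1 \<Otimes>\<^sub>M M2) (E1 \<times> E2) \<le> ennreal (C * r powr s)" .
    qed
  qed (use s in \<open>auto simp: C_def\<close>)
qed

section \<open>The dimension formula\<close>

lemma log_ratio_bounds:
  assumes "1 < \<beta>1" "\<beta>1 \<le> \<beta>2"
  shows "0 < log \<beta>2 \<beta>1" "log \<beta>2 \<beta>1 \<le> 1" "ln \<beta>1 = log \<beta>2 \<beta>1 * ln \<beta>2"
  using assms by (auto simp: log_def)

lemma dim_value_pos:
  assumes "1 < \<beta>1" "\<beta>1 \<le> \<beta>2" "0 \<le> v"
  shows "0 < dim_value \<beta>1 \<beta>2 v"
proof -
  define t where "t = log \<beta>2 \<beta>1"
  have t: "0 < t" "t \<le> 1" using log_ratio_bounds[OF assms(1,2)] by (simp_all only: t_def)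
  have "v * t \<le> v * 1" using t assms by (intro mult_left_mono) auto
  then have "0 < (1 + t) / ((1 + v) * t)" "0 < (2 + v - v * t) / (1 + v)"
    using t assms(3) by (auto intro!: divide_pos_pos add_pos_nonneg)
  then show ?thesis unfolding dim_value_eq_min[OF assms] t_def[symmetric] by simp
qed

text \<open>The two choices \<open>\<gamma> = \<beta>1\<close> and \<open>\<gamma> = \<beta>2\<close> correspond to the two numbers in the minimum.\<close>

lemma W_set_null_above_dim_value:
  assumes b: "1 < \<beta>1" "\<beta>1 \<le> \<beta>2" and v: "0 \<le> v" and s: "dim_value \<beta>1 \<beta>2 v < s"
  shows "hausdorff_measure s (W_set \<beta>1 \<beta>2 v) = 0"
proof -
  define t where "t = log \<beta>2 \<beta>1"
  have t: "0 < t" "ln \<beta>1 = t * ln \<beta>2" using log_ratio_bounds(1,3)[OF b] by (simp_all only: t_def)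
  have l2: "0 < ln \<beta>2" using b by simp
  have s0: "0 < s" using dim_value_pos[OF b v] s by simp
  have "(1 + t) / ((1 + v) * t) < s \<or> (2 + v - v * t) / (1 + v) < s"
    using s dim_value_eq_min[OF b v] by (simp add: t_def min_less_iff_disj)
  then show ?thesis
  proof
    assume "(1 + t) / ((1 + v) * t) < s"
    then have "1 + t < (1 + v) * t * s" using t v by (simp add: pos_divide_less_eq mult_ac)
    then have "(1 + t) * ln \<beta>2 < (1 + v) * t * s * ln \<beta>2" using l2 by (intro mult_strict_right_mono)
    then show ?thesis
      by (intro W_set_null[of \<beta>1 \<beta>1]) (use b v s0 in \<open>auto simp: t algebra_simps\<close>)
  next
    assume "(2 + v - v * t) / (1 + v) < s"
    then have "2 + v - v * t < (1 + v) * s" using v by (simp add: pos_divide_less_eq mult_ac)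
    then have "(2 + v - v * t) * ln \<beta>2 < (1 + v) * s * ln \<beta>2" using l2 by (intro mult_strict_right_mono)
    then show ?thesis
      by (intro W_set_null[of \<beta>1 \<beta>2]) (use b v s0 in \<open>auto simp: t algebra_simps\<close>)
  qed
qed

text \<open>A point of exponent \<open>v\<close> need not lie in \<open>W(v)\<close> itself, since the supremum may fail to be attained; hence
  the passage to smaller exponents.\<close>

lemma hausdorff_dim_A_set_le:
  assumes b: "1 < \<beta>1" "\<beta>1 \<le> \<beta>2" and v: "0 < v"
  shows "hausdorff_dim (A_set \<beta>1 \<beta>2 (ereal v)) \<le> ereal (dim_value \<beta>1 \<beta>2 v)"
proof (rule hausdorff_dim_le)
  show "0 \<le> dim_value \<beta>1 \<beta>2 v" using dim_value_pos[OF b] v by (simp add: less_imp_le)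
  fix s assume s: "dim_value \<beta>1 \<beta>2 v < s"
  define f where "f = (\<lambda>v. min ((1 + log \<beta>2 \<beta>1) / ((1 + v) * log \<beta>2 \<beta>1))
      ((2 + v - v * log \<beta>2 \<beta>1) / (1 + v)))"
  have f: "dim_value \<beta>1 \<beta>2 w = f w" if "0 \<le> w" for w
    using dim_value_eq_min[OF b that] by (simp add: f_def)
  have "(f \<longlongrightarrow> f v) (at_left v)"
    unfolding f_def using v log_ratio_bounds(1)[OF b] by (intro tendsto_intros) auto
  then have "\<forall>\<^sub>F w in at_left v. f w < s" using s f[of v] v by (intro order_tendstoD) auto
  moreover have "\<forall>\<^sub>F w in at_left v. 0 < w \<and> w < v"
    using eventually_at_left_real[OF v] by (rule eventually_mono) auto
  ultimately have "\<forall>\<^sub>F w in at_left v. f w < s \<and> 0 < w \<and> w < v" by (rule eventually_conj)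
  then obtain w where w: "f w < s" "0 < w" "w < v"
    using eventually_happens'[OF trivial_limit_at_left_real] by blast
  have "hausdorff_measure s (W_set \<beta>1 \<beta>2 w) = 0"
    using w f[of w] by (intro W_set_null_above_dim_value b) auto
  moreover have "A_set \<beta>1 \<beta>2 (ereal v) \<subseteq> W_set \<beta>1 \<beta>2 w"
    using w b by (intro A_set_subset_W_set) auto
  ultimately show "hausdorff_measure s (A_set \<beta>1 \<beta>2 (ereal v)) = 0"
    using hausdorff_measure_mono by (metis le_zero_eq)
qed

lemma hausdorff_dim_A_W_ge:
  assumes b: "1 < \<beta>1" "\<beta>1 \<le> \<beta>2" and v: "0 \<le> v"
  shows "ereal (dim_value \<beta>1 \<beta>2 v) \<le> hausdorff_dim (A_set \<beta>1 \<beta>2 (ereal v))"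
    and "ereal (dim_value \<beta>1 \<beta>2 v) \<le> hausdorff_dim (W_set \<beta>1 \<beta>2 v)"
proof -
  have "hausdorff_measure s B \<noteq> 0"
    if "0 < s" "s < dim_value \<beta>1 \<beta>2 v" "A_set \<beta>1 \<beta>2 (ereal v) \<inter> W_set \<beta>1 \<beta>2 v \<subseteq> B" for s B
    using hausdorff_measure_A_W_positive[OF b v that(1,2)] hausdorff_measure_mono[OF that(3)]
    by (metis le_zero_eq)
  then show "ereal (dim_value \<beta>1 \<beta>2 v) \<le> hausdorff_dim (A_set \<beta>1 \<beta>2 (ereal v))"
    and "ereal (dim_value \<beta>1 \<beta>2 v) \<le> hausdorff_dim (W_set \<beta>1 \<beta>2 v)"
    by (intro hausdorff_dim_ge; blast)+
qed

lemma hausdorff_dim_A_set_0: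
  assumes b: "1 < \<beta>1" "\<beta>1 \<le> \<beta>2"
  shows "hausdorff_dim (A_set \<beta>1 \<beta>2 0) = 2"
proof -
  have "2 \<le> (1 + log \<beta>2 \<beta>1) / log \<beta>2 \<beta>1"
    using log_ratio_bounds(1,2)[OF b] by (subst pos_le_divide_eq) linarith+
  then have dim: "dim_value \<beta>1 \<beta>2 0 = 2"
    using dim_value_eq_min[OF b order_refl] by simp
  have "hausdorff_measure s (A_set \<beta>1 \<beta>2 0) = 0" if "2 < s" for s
  proof -
    have "hausdorff_measure s (W_set \<beta>1 \<beta>2 0) = 0"
      using that by (intro W_set_null_above_dim_value b) (auto simp: dim)
    moreover have "A_set \<beta>1 \<beta>2 0 \<subseteq> W_set \<beta>1 \<beta>2 0" using b by (intro A_set_subset_W_set) auto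
    ultimately show ?thesis using hausdorff_measure_mono by (metis le_zero_eq)
  qed
  then have "hausdorff_dim (A_set \<beta>1 \<beta>2 0) \<le> ereal 2" by (intro hausdorff_dim_le) auto
  moreover have "ereal 2 \<le> hausdorff_dim (A_set \<beta>1 \<beta>2 0)"
    using hausdorff_dim_A_W_ge(1)[OF b order_refl] by (simp add: dim zero_ereal_def[symmetric])
  ultimately show ?thesis by (simp add: antisym)
qed

lemma hausdorff_dim_A_set_infinity:
  assumes b: "1 < \<beta>1" "\<beta>1 \<le> \<beta>2"
  shows "hausdorff_dim (A_set \<beta>1 \<beta>2 \<infinity>) = 0"
proof -
  define t where "t = log \<beta>2 \<beta>1"
  have t: "0 < t" using log_ratio_bounds(1)[OF b] by (simp only: t_def)
  have "hausdorff_measure s (A_set \<beta>1 \<beta>2 \<infinity>) = 0" if s: "0 < s" for s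
  proof -
    define v where "v = (1 + t) / (t * s)"
    have v: "0 \<le> v" using t s by (simp add: v_def)
    have "(1 + t) / ((1 + v) * t) < s"
    proof -
      have "v * t * s = 1 + t" using t s by (simp add: v_def)
      then show ?thesis using t s v by (simp add: pos_divide_less_eq algebra_simps add_pos_nonneg)
    qed
    then have "dim_value \<beta>1 \<beta>2 v < s"
      using dim_value_eq_min[OF b v] by (simp add: t_def min_less_iff_disj)
    then have "hausdorff_measure s (W_set \<beta>1 \<beta>2 v) = 0"
      by (intro W_set_null_above_dim_value b v)
    moreover have "A_set \<beta>1 \<beta>2 \<infinity> \<subseteq> W_set \<beta>1 \<beta>2 v" using b by (intro A_set_subset_W_set) auto
    ultimately show ?thesis using hausdorff_measure_mono by (metis le_zero_eq)
  qed
  then have "hausdorff_dim (A_set \<beta>1 \<beta>2 \<infinity>) \<le> ereal 0" by (intro hausdorff_dim_le) auto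
  moreover have "ereal 0 \<le> hausdorff_dim (A_set \<beta>1 \<beta>2 \<infinity>)" by (rule hausdorff_dim_ge) simp
  ultimately show ?thesis by (simp add: antisym zero_ereal_def)
qed

theorem theorem1p7:
  fixes \<beta>1 \<beta>2 :: real
  assumes "1 < \<beta>1" and "\<beta>1 \<le> \<beta>2"
  shows "(\<forall>v::real. 0 < v \<longrightarrow>
            hausdorff_dim (A_set \<beta>1 \<beta>2 (ereal v)) = ereal (dim_value \<beta>1 \<beta>2 v)
          \<and> hausdorff_dim (W_set \<beta>1 \<beta>2 v) = ereal (dim_value \<beta>1 \<beta>2 v))
       \<and> hausdorff_dim (A_set \<beta>1 \<beta>2 0) = 2
       \<and> hausdorff_dim (A_set \<beta>1 \<beta>2 \<infinity>) = 0"
proof (intro conjI allI impI)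
  fix v :: real assume v: "0 < v"
  then have v0: "0 \<le> v" by simp
  show "hausdorff_dim (A_set \<beta>1 \<beta>2 (ereal v)) = ereal (dim_value \<beta>1 \<beta>2 v)"
    using hausdorff_dim_A_set_le[OF assms v] hausdorff_dim_A_W_ge(1)[OF assms v0] by (rule antisym)
  have "hausdorff_dim (W_set \<beta>1 \<beta>2 v) \<le> ereal (dim_value \<beta>1 \<beta>2 v)"
    using dim_value_pos[OF assms v0] W_set_null_above_dim_value[OF assms v0]
    by (intro hausdorff_dim_le) auto
  then show "hausdorff_dim (W_set \<beta>1 \<beta>2 v) = ereal (dim_value \<beta>1 \<beta>2 v)"
    using hausdorff_dim_A_W_ge(2)[OF assms v0] by (rule antisym)
next
  show "hausdorff_dim (A_set \<beta>1 \<beta>2 0) = 2" by (rule hausdorff_dim_A_set_0[OF assms])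
  show "hausdorff_dim (A_set \<beta>1 \<beta>2 \<infinity>) = 0" by (rule hausdorff_dim_A_set_infinity[OF assms])
qed

end
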